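(* Let $n>m\geq 2$, and let $g\geq 1$. There exists a primitive representation $\rho_{n,m}\colon B_n(\Sigma_g)\to S_m$ if and only if $m$ is prime. This being the case, for any primitive representation $\rho_{n,m}\colon B_n(\Sigma_g)\to S_m$, one of the following statements holds: (a) the image $\operatorname{Im}(\rho_{n,m})$ is generated by an $m$-cycle, unless $m=2$, in which case $\operatorname{Im}(\rho_{n,2})$ can also be equal to $\{\operatorname{Id}\}$; (b) $n=4$ and $m=3$, and up to a suitable renumbering of the elements of the set $\{1,2,3\}$, $\rho_{4,3}(\sigma_1)=\rho_{4,3}(\sigma_3)=(1,2)$, $\rho_{4,3}(\sigma_2)=(2,3)$, and for all $1\leq i\leq g$, the permutations $\rho_{4,3}(a_i)$ and $\rho_{4,3}(b_i)$ are trivial, where $\{\sigma_1,\sigma_2,\sigma_3,a_1,b_1,\ldots,a_g,b_g\}$ is the standard generating set of $B_4(\Sigma_g)$ given in the context.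
   Context: $\Sigma_g$ is the compact, connected, orientable surface of genus $g$ without boundary, and $B_n(\Sigma_g)$ is its $n$-string braid group, that is, the fundamental group of the quotient by $S_n$ (permuting coordinates) of the configuration space of ordered $n$-tuples of pairwise distinct points of $\Sigma_g$. For $g,n\geq 1$ it admits the following presentation. Generators: $a_1,b_1,\ldots,a_g,b_g,\sigma_1,\ldots,\sigma_{n-1}$. Relations: - $\sigma_i\sigma_j=\sigma_j\sigma_i$ if $|i-j|\geq 2$; - $\sigma_i\sigma_{i+1}\sigma_i=\sigma_{i+1}\sigma_i\sigma_{i+1}$ for $1\leq i\leq n-2$; - $c_i\sigma_j=\sigma_jc_i$ for all $j\geq 2$, $c_i=a_i$ or $b_i$, $i=1,\ldots,g$; - $c_i\sigma_1c_i\sigma_1=\sigma_1c_i\sigma_1c_i$ for $c_i=a_i$ or $b_i$, $i=1,\ldots,g$; - $a_i\sigma_1b_i=\sigma_1b_i\sigma_1a_i\sigma_1$ for $i=1,\ldots,g$; - $c_i\sigma_1^{-1}c_j\sigma_1=\sigma_1^{-1}c_j\sigma_1c_i$ for $c_i=a_i$ or $b_i$, $c_j=a_j$ or $b_j$, $1\leq j<i\leq g$; - $\prod_{i=1}^g[a_i^{-1},b_i]=\sigma_1\cdots\sigma_{n-2}\sigma_{n-1}^2\sigma_{n-2}\cdots\sigma_1$. Here $[x,y]=xyx^{-1}y^{-1}$. A representation (homomorphism) $\rho\colon B_n(\Sigma_g)\to S_m$ is called primitive if the only partitions of $\{1,\ldots,m\}$ that are left invariant by the action of $\operatorname{Im}(\rho)$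 are the partition with the single block $\{1,\ldots,m\}$ and the partition into singletons. (In particular, for $m=2$ the trivial homomorphism is primitive under this definition.) *)

theory Defs
  imports
    "HOL-Algebra.Sym_Groups"
    "HOL-Computational_Algebra.Primes"
    "HOL-Library.Disjoint_Sets"
begin

section \<open>Groups given by generators and relations\<close>

text \<open>
  A word is a list of signed letters: \<open>(x, True)\<close> stands for the generator \<open>x\<close> and
  \<open>(x, False)\<close> for its inverse. A pair \<open>(u, v)\<close> of words in \<open>R\<close> is the relation \<open>u = v\<close>.
  The presented group is the set of all words over \<open>X\<close> modulo the congruence generated by
  free cancellation and by \<open>R\<close>, which is the quotient of the free group on \<open>X\<close> by the
  normal closure of the elements \<open>u v\<^sup>-\<^sup>1\<close>. A pair in \<open>R\<close> which is not a pair of words over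
  \<open>X\<close> is ignored.
\<close>

type_synonym 'x word = "('x \<times> bool) list"

definition words :: "'x set \<Rightarrow> 'x word set" where
  "words X = lists (X \<times> UNIV)"

inductive pres_step :: "'x set \<Rightarrow> ('x word \<times> 'x word) set \<Rightarrow> 'x word \<Rightarrow> 'x word \<Rightarrow> bool"
  for X R where
  cancel: "p \<in> words X \<Longrightarrow> q \<in> words X \<Longrightarrow> x \<in> X \<Longrightarrow>
             pres_step X R (p @ [(x, e), (x, \<not> e)] @ q) (p @ q)"
| rel: "p \<in> words X \<Longrightarrow> q \<in> words X \<Longrightarrow> u \<in> words X \<Longrightarrow> v \<in> words X \<Longrightarrow> (u, v) \<in> R \<Longrightarrow>
          pres_step X R (p @ u @ q) (p @ v @ q)"

definition pres_eq :: "'x set \<Rightarrow> ('x word \<times> 'x word) set \<Rightarrow> ('x word \<times> 'x word) set" where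
  "pres_eq X R = {(u, v). u \<in> words X \<and> v \<in> words X \<and> equivclp (pres_step X R) u v}"

definition presented_group :: "'x set \<Rightarrow> ('x word \<times> 'x word) set \<Rightarrow> 'x word set monoid" where
  "presented_group X R =
     \<lparr> carrier = words X // pres_eq X R,
       mult = (\<lambda>U V. \<Union>u\<in>U. \<Union>v\<in>V. pres_eq X R `` {u @ v}),
       one = pres_eq X R `` {[]} \<rparr>"

definition pres_gen :: "'x set \<Rightarrow> ('x word \<times> 'x word) set \<Rightarrow> 'x \<Rightarrow> 'x word set" where
  "pres_gen X R x = pres_eq X R `` {[(x, True)]}"

lemma words_simps [simp]:
  "[] \<in> words X"
  "l # u \<in> words X \<longleftrightarrow> fst l \<in> X \<and> u \<in> words X"
  "u @ v \<in> words X \<longleftrightarrow> u \<in> words X \<and> v \<in> words X"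
  by (auto simp: words_def mem_Times_iff)

lemma equiv_pres_eq: "equiv (words X) (pres_eq X R)"
proof (rule equivI)
  show "pres_eq X R \<subseteq> words X \<times> words X"
    by (auto simp: pres_eq_def)
  show "refl_on (words X) (pres_eq X R)"
    by (auto simp: refl_on_def pres_eq_def)
  show "sym (pres_eq X R)"
    by (auto simp: sym_def pres_eq_def intro: equivclp_sym)
  show "trans (pres_eq X R)"
    by (auto simp: trans_def pres_eq_def intro: equivclp_trans)
qed

lemma pres_step_append:
  assumes "pres_step X R u v" "p \<in> words X" "q \<in> words X"
  shows "pres_step X R (p @ u @ q) (p @ v @ q)"
  using assms(1)
proof cases
  case (cancel p' q' x e)
  then show ?thesis
    using pres_step.cancel[of "p @ p'" X "q' @ q" x R e] assms by simp
next
  case (rel p' q' u' v')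
  then show ?thesis
    using pres_step.rel[of "p @ p'" X "q' @ q" u' v' R] assms by simp
qed

lemma equivclp_append:
  assumes "equivclp (pres_step X R) u v" "p \<in> words X" "q \<in> words X"
  shows "equivclp (pres_step X R) (p @ u @ q) (p @ v @ q)"
  using assms(1)
proof (induction rule: equivclp_induct)
  case base
  then show ?case by simp
next
  case (step y z)
  then have "equivclp (pres_step X R) (p @ y @ q) (p @ z @ q)"
    using pres_step_append[OF _ assms(2,3)]
    by (auto intro: r_into_equivclp converse_r_into_equivclp)
  with step.IH show ?case
    by (rule equivclp_trans)
qed

lemma pres_eq_append:
  assumes "(u, u') \<in> pres_eq X R" "(v, v') \<in> pres_eq X R"
  shows "(u @ v, u' @ v') \<in> pres_eq X R"
proof -
  have "equivclp (pres_step X R) (u @ v) (u' @ v)"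
    using equivclp_append[of X R u u' "[]" v] assms by (simp add: pres_eq_def)
  moreover have "equivclp (pres_step X R) (u' @ v) (u' @ v')"
    using equivclp_append[of X R v v' u' "[]"] assms by (simp add: pres_eq_def)
  ultimately show ?thesis
    using assms by (auto simp: pres_eq_def intro: equivclp_trans)
qed

lemma presented_group_mult:
  assumes "u \<in> words X" "v \<in> words X"
  shows "pres_eq X R `` {u} \<otimes>\<^bsub>presented_group X R\<^esub> pres_eq X R `` {v} = pres_eq X R `` {u @ v}"
proof -
  have "congruent2 (pres_eq X R) (pres_eq X R) (\<lambda>u v. pres_eq X R `` {u @ v})"
    by (auto simp: congruent2_def intro!: equiv_class_eq[OF equiv_pres_eq] pres_eq_append)
  from UN_equiv_class2[OF equiv_pres_eq equiv_pres_eq this assms]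
  show ?thesis by (simp add: presented_group_def)
qed

lemma pres_eq_inverse:
  assumes "u \<in> words X"
  shows "map (\<lambda>(x, e). (x, \<not> e)) (rev u) \<in> words X"
    and "(map (\<lambda>(x, e). (x, \<not> e)) (rev u) @ u, []) \<in> pres_eq X R"
proof -
  have "map (\<lambda>(x, e). (x, \<not> e)) (rev u) \<in> words X \<and>
        (map (\<lambda>(x, e). (x, \<not> e)) (rev u) @ u, []) \<in> pres_eq X R"
    using assms
  proof (induction u)
    case Nil
    then show ?case by (simp add: pres_eq_def)
  next
    case (Cons l u)
    obtain x e where l: "l = (x, e)" by (cases l)
    let ?w = "map (\<lambda>(x, e). (x, \<not> e)) (rev u)"
    have *: "?w \<in> words X" "(?w @ u, []) \<in> pres_eq X R" "u \<in> words X" "x \<in> X"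
      using Cons l by auto
    have "pres_step X R (?w @ [(x, \<not> e), (x, \<not> \<not> e)] @ u) (?w @ u)"
      using * by (intro pres_step.cancel) auto
    with * show ?case
      by (auto simp: pres_eq_def l intro: equivclp_trans r_into_equivclp)
  qed
  then show "map (\<lambda>(x, e). (x, \<not> e)) (rev u) \<in> words X"
    and "(map (\<lambda>(x, e). (x, \<not> e)) (rev u) @ u, []) \<in> pres_eq X R" by auto
qed

lemma group_presented_group: "group (presented_group X R)"
proof (rule groupI)
  let ?G = "presented_group X R" and ?E = "pres_eq X R"
  have car: "carrier ?G = words X // ?E" and one: "\<one>\<^bsub>?G\<^esub> = ?E `` {[]}"
    by (simp_all add: presented_group_def)
  have mem: "?E `` {u} \<in> carrier ?G" if "u \<in> words X" for u
    using that by (simp add: car quotientI)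
  note rep = quotientE[of _ "words X" ?E, folded car]
  show "\<one>\<^bsub>?G\<^esub> \<in> carrier ?G" by (simp add: one mem)
  fix U assume U: "U \<in> carrier ?G"
  then obtain u where u: "U = ?E `` {u}" "u \<in> words X" by (elim rep)
  show "\<one>\<^bsub>?G\<^esub> \<otimes>\<^bsub>?G\<^esub> U = U"
    using u by (simp add: one presented_group_mult)
  show "\<exists>V\<in>carrier ?G. V \<otimes>\<^bsub>?G\<^esub> U = \<one>\<^bsub>?G\<^esub>"
    using pres_eq_inverse[OF u(2)] u
    by (intro bexI[of _ "?E `` {map (\<lambda>(x, e). (x, \<not> e)) (rev u)}"])
       (auto simp: one presented_group_mult mem intro!: equiv_class_eq[OF equiv_pres_eq])
  fix V assume V: "V \<in> carrier ?G"
  then obtain v where v: "V = ?E `` {v}" "v \<in> words X" by (elim rep)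
  show "U \<otimes>\<^bsub>?G\<^esub> V \<in> carrier ?G"
    using u v by (simp add: presented_group_mult mem)
  fix W assume "W \<in> carrier ?G"
  then obtain w where w: "W = ?E `` {w}" "w \<in> words X" by (elim rep)
  show "(U \<otimes>\<^bsub>?G\<^esub> V) \<otimes>\<^bsub>?G\<^esub> W = U \<otimes>\<^bsub>?G\<^esub> (V \<otimes>\<^bsub>?G\<^esub> W)"
    using u v w by (simp add: presented_group_mult)
qed

section \<open>Surface braid groups\<close>

datatype braid_gen = Gen_a nat | Gen_b nat | Gen_s nat

definition braid_gens :: "nat \<Rightarrow> nat \<Rightarrow> braid_gen set" where
  "braid_gens g n = Gen_a ` {1..g} \<union> Gen_b ` {1..g} \<union> Gen_s ` {1..<n}"

abbreviation ltr :: "'x \<Rightarrow> 'x \<times> bool" where "ltr x \<equiv> (x, True)"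
abbreviation ltr_inv :: "'x \<Rightarrow> 'x \<times> bool" where "ltr_inv x \<equiv> (x, False)"

text \<open>
  In the last rule the left-hand side is the product of the commutators
  \<open>[a\<^sub>i\<^sup>-\<^sup>1, b\<^sub>i] = a\<^sub>i\<^sup>-\<^sup>1 b\<^sub>i a\<^sub>i b\<^sub>i\<^sup>-\<^sup>1\<close>, in the order of increasing \<open>i\<close>.
\<close>

inductive_set braid_rels :: "nat \<Rightarrow> nat \<Rightarrow> (braid_gen word \<times> braid_gen word) set"
  for g n :: nat where
  far_comm: "\<lbrakk>i \<in> {1..<n}; j \<in> {1..<n}; i + 2 \<le> j \<or> j + 2 \<le> i\<rbrakk> \<Longrightarrow>
    ([ltr (Gen_s i), ltr (Gen_s j)], [ltr (Gen_s j), ltr (Gen_s i)]) \<in> braid_rels g n"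
| braid: "\<lbrakk>1 \<le> i; i + 2 \<le> n\<rbrakk> \<Longrightarrow>
    ([ltr (Gen_s i), ltr (Gen_s (i + 1)), ltr (Gen_s i)],
     [ltr (Gen_s (i + 1)), ltr (Gen_s i), ltr (Gen_s (i + 1))]) \<in> braid_rels g n"
| handle_comm: "\<lbrakk>i \<in> {1..g}; c \<in> {Gen_a i, Gen_b i}; 2 \<le> j; j < n\<rbrakk> \<Longrightarrow>
    ([ltr c, ltr (Gen_s j)], [ltr (Gen_s j), ltr c]) \<in> braid_rels g n"
| handle_square: "\<lbrakk>i \<in> {1..g}; c \<in> {Gen_a i, Gen_b i}\<rbrakk> \<Longrightarrow>
    ([ltr c, ltr (Gen_s 1), ltr c, ltr (Gen_s 1)],
     [ltr (Gen_s 1), ltr c, ltr (Gen_s 1), ltr c]) \<in> braid_rels g n"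
| handle_pair: "i \<in> {1..g} \<Longrightarrow>
    ([ltr (Gen_a i), ltr (Gen_s 1), ltr (Gen_b i)],
     [ltr (Gen_s 1), ltr (Gen_b i), ltr (Gen_s 1), ltr (Gen_a i), ltr (Gen_s 1)])
      \<in> braid_rels g n"
| handles_comm: "\<lbrakk>1 \<le> j; j < i; i \<le> g; c \<in> {Gen_a i, Gen_b i}; d \<in> {Gen_a j, Gen_b j}\<rbrakk> \<Longrightarrow>
    ([ltr c, ltr_inv (Gen_s 1), ltr d, ltr (Gen_s 1)],
     [ltr_inv (Gen_s 1), ltr d, ltr (Gen_s 1), ltr c]) \<in> braid_rels g n"
| surface:
    "(concat (map (\<lambda>i. [ltr_inv (Gen_a i), ltr (Gen_b i), ltr (Gen_a i), ltr_inv (Gen_b i)])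
                  [1..<g + 1]),
      map (\<lambda>i. ltr (Gen_s i)) ([1..<n] @ rev [1..<n])) \<in> braid_rels g n"

text \<open>
  \<open>surface_braid_group g n\<close> is the \<open>n\<close>-string braid group of the compact connected orientable
  surface of genus \<open>g\<close> without boundary, for \<open>g, n \<ge> 1\<close>. It is given by its standard
  presentation, since results about it are stated in terms of the standard generators; the identification
  with the fundamental group of the unordered configuration space is not formalized.
  For \<open>n = 1\<close> there is no generator \<open>Gen_s 1\<close>, and the relations that mention it are void.
\<close>

definition surface_braid_group :: "nat \<Rightarrow> nat \<Rightarrow> braid_gen word set monoid" where
  "surface_braid_group g n = presented_group (braid_gens g n) (braid_rels g n)"

definition sbg_gen :: "nat \<Rightarrow> nat \<Rightarrow> braid_gen \<Rightarrow> braid_gen word set" where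
  "sbg_gen g n = pres_gen (braid_gens g n) (braid_rels g n)"

section \<open>Primitive representations\<close>

definition invariant_partition :: "nat \<Rightarrow> (nat \<Rightarrow> nat) set \<Rightarrow> nat set set \<Rightarrow> bool" where
  "invariant_partition m H P \<longleftrightarrow>
     partition_on {1..m} P \<and> (\<forall>h\<in>H. \<forall>A\<in>P. h ` A \<in> P)"

definition primitive_rep :: "nat \<Rightarrow> nat \<Rightarrow> nat \<Rightarrow> (braid_gen word set \<Rightarrow> nat \<Rightarrow> nat) \<Rightarrow> bool" where
  "primitive_rep g n m \<rho> \<longleftrightarrow>
     \<rho> \<in> hom (surface_braid_group g n) (sym_group m) \<and>
     (\<forall>P. invariant_partition m (\<rho> ` carrier (surface_braid_group g n)) P \<longrightarrow>
          P = {{1..m}} \<or> P = (\<lambda>k. {k}) ` {1..m})"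

definition is_full_cycle :: "nat \<Rightarrow> (nat \<Rightarrow> nat) \<Rightarrow> bool" where
  "is_full_cycle m c \<longleftrightarrow> (\<exists>cs. cycle cs \<and> set cs = {1..m} \<and> c = cycle_of_list cs)"

end

theory Submission
  imports Defs
begin

text \<open>
  A representation restricts to an action of Artin's braid group on \<open>m < n\<close> points. If \<open>n = 3\<close> or
  \<open>n \<ge> 5\<close>, all \<open>\<sigma>\<^sub>i\<close> have the same image (Artin). To see this, let \<open>\<sigma>\<^sub>3, \<dots>, \<sigma>\<^bsub>n-1\<^esub>\<close>, which commute with
  \<open>\<sigma>\<^sub>1\<close>, act on the fixed points and on the nontrivial orbits of \<open>\<sigma>\<^sub>1\<close>; both sets have fewer than \<open>n - 2\<close>
  elements, so by induction these generators agree up to powers of \<open>\<sigma>\<^sub>1\<close> that depend on the orbit. Comparing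
  \<open>\<sigma>\<^sub>3\<close> and \<open>\<sigma>\<^sub>4\<close> with \<open>\<sigma>\<^sub>6\<close> shows that they commute, and commuting neighbours are equal by the braid
  relation. For \<open>n = 5, 6\<close> there is no room for the induction and small sets are treated directly.

  When all \<open>\<sigma>\<^sub>i\<close> have the same image \<open>s\<close>, then \<open>s\<close> is central, and if \<open>s = 1\<close> the image is abelian.
  So a nontrivial image contains a nontrivial central \<open>z\<close>. The orbits of each power of \<open>z\<close> form an
  invariant partition, so primitivity makes every nontrivial power of \<open>z\<close> transitive: \<open>z\<close> is an
  \<open>m\<close>-cycle, \<open>m\<close> is prime, and the image, which centralizes \<open>z\<close>, consists of powers of \<open>z\<close>.
\<close>

section \<open>Orbits of a single map\<close>

text \<open>Only forward iterates are taken. For a bijection of a finite set they already fill the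
  whole orbit, because the inverse is a positive power; \<open>orbit_of_sym\<close> supplies
  this.\<close>

definition orbit_of :: "('a \<Rightarrow> 'a) \<Rightarrow> 'a \<Rightarrow> 'a set" where
  "orbit_of f x = range (\<lambda>k. (f ^^ k) x)"

lemma orbit_of_self [simp]: "x \<in> orbit_of f x"
  by (auto simp: orbit_of_def intro: range_eqI[of _ _ 0])

lemma orbit_of_step: "f x \<in> orbit_of f x"
  by (auto simp: orbit_of_def intro: range_eqI[of _ _ 1])

lemma funpow_funpow: "(f ^^ i) ((f ^^ j) x) = (f ^^ (i + j)) x"
  by (simp add: funpow_add)

lemma orbit_of_trans: "z \<in> orbit_of f y \<Longrightarrow> y \<in> orbit_of f x \<Longrightarrow> z \<in> orbit_of f x"
  by (auto simp: orbit_of_def funpow_funpow)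

lemma funpow_closed: "f ` X \<subseteq> X \<Longrightarrow> x \<in> X \<Longrightarrow> (f ^^ k) x \<in> X"
  by (induction k) auto

lemma orbit_of_subset: "f ` X \<subseteq> X \<Longrightarrow> x \<in> X \<Longrightarrow> orbit_of f x \<subseteq> X"
  by (auto simp: orbit_of_def intro: funpow_closed)

lemma funpow_commute_on:
  assumes "f ` X \<subseteq> X" "\<And>y. y \<in> X \<Longrightarrow> g (f y) = f (g y)" "x \<in> X"
  shows "g ((f ^^ k) x) = (f ^^ k) (g x)"
  using assms by (induction k) (auto simp: funpow_closed)

lemma image_orbit_of:
  assumes "f ` X \<subseteq> X" "\<And>y. y \<in> X \<Longrightarrow> g (f y) = f (g y)" "x \<in> X"
  shows "g ` orbit_of f x = orbit_of f (g x)"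
  using funpow_commute_on[of f X g, OF assms] by (auto simp: orbit_of_def image_image)

text \<open>By pigeonhole two iterates of \<open>x\<close> coincide, and cancelling the smaller
  power leaves a positive period \<open>d\<close>. From \<open>(f ^^ k) x\<close> another
  \<open>d * k - k\<close> steps lead to \<open>(f ^^ (d * k)) x = x\<close>.\<close>

lemma orbit_of_sym:
  assumes "finite X" "bij_betw f X X" "x \<in> X" "y \<in> orbit_of f x"
  shows "x \<in> orbit_of f y"
proof -
  have fX: "f ` X \<subseteq> X" using assms(2) by (simp add: bij_betw_def)
  obtain k where y: "y = (f ^^ k) x" using assms(4) by (auto simp: orbit_of_def)
  have "inj_on (f ^^ k) X" for k
    using bij_betw_funpow[OF assms(2)] by (auto simp: bij_betw_def)
  have "\<exists>d>0. (f ^^ d) x = x"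
  proof -
    have "\<not> inj (\<lambda>i. (f ^^ i) x)"
      using finite_subset[OF orbit_of_subset[OF fX assms(3)] assms(1)]
        finite_imageD[of "\<lambda>i. (f ^^ i) x" UNIV] infinite_UNIV_nat
      unfolding orbit_of_def by blast
    then obtain i j where "i < j" "(f ^^ i) x = (f ^^ j) x"
      unfolding inj_def by (metis linorder_neqE_nat)
    then have "(f ^^ i) ((f ^^ (j - i)) x) = (f ^^ i) x"
      by (simp add: funpow_funpow)
    then have "(f ^^ (j - i)) x = x"
      using \<open>inj_on (f ^^ i) X\<close> assms(3) funpow_closed[OF fX] by (auto dest: inj_onD)
    then show ?thesis using \<open>i < j\<close> by (intro exI[of _ "j - i"]) auto
  qed
  then obtain d where d: "d > 0" "(f ^^ d) x = x" by blast
  have "(f ^^ (d * k)) x = x"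
    using d(2) by (induction k) (simp_all add: funpow_add)
  \<comment> \<open>The subtraction does not truncate because \<open>d\<close> is positive.\<close>
  moreover have "d * k - k + k = d * k" using d(1) by simp
  ultimately have "(f ^^ (d * k - k)) y = x"
    unfolding y funpow_funpow by simp
  then show ?thesis by (auto simp: orbit_of_def)
qed

lemma orbit_of_eq:
  assumes "finite X" "bij_betw f X X" "x \<in> X" "y \<in> orbit_of f x"
  shows "orbit_of f y = orbit_of f x"
  using orbit_of_sym[OF assms] assms(4) by (auto intro: orbit_of_trans)

lemma orbit_of_fixed: "f x = x \<Longrightarrow> orbit_of f x = {x}"
proof -
  assume "f x = x"
  then have "(f ^^ k) x = x" for k by (induction k) auto
  then show ?thesis by (auto simp: orbit_of_def)
qed

section \<open>Actions of the braid group on few points\<close>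

text \<open>The relations are demanded pointwise on \<open>X\<close> only, so that the same locale
  covers restrictions to invariant subsets and the induced action on sets of points.\<close>

locale braid_action =
  fixes n :: nat and X :: "'a set" and t :: "nat \<Rightarrow> 'a \<Rightarrow> 'a"
  assumes finite: "finite X"
    and bij: "\<lbrakk>1 \<le> i; i < n\<rbrakk> \<Longrightarrow> bij_betw (t i) X X"
    and far: "\<lbrakk>1 \<le> i; i + 2 \<le> j; j < n; x \<in> X\<rbrakk> \<Longrightarrow> t i (t j x) = t j (t i x)"
    and braid: "\<lbrakk>1 \<le> i; i + 1 < n; x \<in> X\<rbrakk> \<Longrightarrow>
      t i (t (i + 1) (t i x)) = t (i + 1) (t i (t (i + 1) x))"
begin

section \<open>Elementary consequences of the braid relations\<close>

lemma closed [simp]: "\<lbrakk>1 \<le> i; i < n; x \<in> X\<rbrakk> \<Longrightarrow> t i x \<in> X"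
  using bij by (meson bij_betw_apply)

lemma cancel: "\<lbrakk>t i x = t i y; 1 \<le> i; i < n; x \<in> X; y \<in> X\<rbrakk> \<Longrightarrow> x = y"
  using bij by (metis bij_betw_imp_inj_on inj_on_def)

lemma surjE:
  assumes "1 \<le> i" "i < n" "y \<in> X"
  obtains x where "x \<in> X" "y = t i x"
  using bij[OF assms(1,2)] assms(3) by (auto simp: bij_betw_def)

text \<open>For commuting \<open>s\<close>, \<open>s'\<close> the braid relation
  \<open>s s' s = s' s s'\<close> becomes \<open>s s s' = s s' s'\<close>, and cancellation gives
  \<open>s = s'\<close>.\<close>

lemma commuting_neighbours_eq:
  assumes i: "1 \<le> i" "i + 1 < n"
    and comm: "\<And>x. x \<in> X \<Longrightarrow> t i (t (i + 1) x) = t (i + 1) (t i x)"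
    and "x \<in> X"
  shows "t i x = t (i + 1) x"
proof -
  obtain y where y: "y \<in> X" "x = t (i + 1) y"
    using surjE[of "i + 1" x] assms by auto
  have "t i (t i x) = t i (t (i + 1) x)"
    using braid[of i y] comm[of "y"] comm[of "t (i + 1) y"] i y by simp
  then show ?thesis
    using i \<open>x \<in> X\<close> by (auto dest: cancel)
qed

text \<open>Equality spreads along the chain: if \<open>t k\<close> and \<open>t (k + 1)\<close>
  agree, then \<open>t (k + 2)\<close>, which commutes with the first, commutes with its neighbour
  \<open>t (k + 1)\<close> and hence equals it. The downward direction is symmetric.\<close>

lemma neighbours_eq_imp_const:
  assumes i: "1 \<le> i" "i + 1 < n" and eq: "\<And>x. x \<in> X \<Longrightarrow> t i x = t (i + 1) x"
    and j: "1 \<le> j" "j < n" and x: "x \<in> X"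
  shows "t j x = t i x"
proof -
  have up: "\<forall>x\<in>X. t k x = t i x \<and> t (k + 1) x = t i x" if "i \<le> k" "k + 1 < n" for k
    using that
  proof (induction k rule: dec_induct)
    case base
    then show ?case using eq by simp
  next
    case (step k)
    have IH: "\<And>x. x \<in> X \<Longrightarrow> t k x = t i x" "\<And>x. x \<in> X \<Longrightarrow> t (k + 1) x = t i x"
      using step by auto
    have "t (k + 1) x = t (k + 1 + 1) x" if "x \<in> X" for x
      using that far[of k "k + 2"] IH i step.hyps step.prems
      by (intro commuting_neighbours_eq) auto
    then show ?case using IH by simp
  qed
  have down: "\<forall>x\<in>X. t k x = t i x \<and> t (k + 1) x = t i x" if "k \<le> i" "1 \<le> k" for k
    using that
  proof (induction k rule: inc_induct)
    case base
    then show ?case using eq by simp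
  next
    case (step k)
    have IH: "\<And>x. x \<in> X \<Longrightarrow> t (k + 1) x = t i x" "\<And>x. x \<in> X \<Longrightarrow> t (k + 2) x = t i x"
      using step by auto
    have "t k x = t (k + 1) x" if "x \<in> X" for x
      using that far[of k "k + 2"] IH i step.hyps step.prems
      by (intro commuting_neighbours_eq) auto
    then show ?case using IH by simp
  qed
  show ?thesis
  proof (cases "j \<le> i")
    case True
    then show ?thesis using down[of j] j x by auto
  next
    case False
    then show ?thesis using up[of "j - 1"] j x by auto
  qed
qed

text \<open>Dropping the first \<open>l\<close> generators leaves the relations for \<open>k\<close>
  strands. Invariance may be stated as an inclusion, since an injective self-map of the finite set
  \<open>Y\<close> is onto.\<close>

lemma subaction:
  assumes "Y \<subseteq> X" "k + l \<le> n"
    and "\<And>i. \<lbrakk>1 \<le> i; i < k\<rbrakk> \<Longrightarrow> t (i + l) ` Y \<subseteq> Y"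
  shows "braid_action k Y (\<lambda>i. t (i + l))"
proof
  show "finite Y" using assms(1) finite by (rule finite_subset)
  show "bij_betw (t (i + l)) Y Y" if "1 \<le> i" "i < k" for i
  proof -
    have "inj_on (t (i + l)) Y"
      using bij[of "i + l"] that assms(1,2) by (auto simp: bij_betw_def intro: inj_on_subset)
    then show ?thesis
      using assms(3)[OF that] \<open>finite Y\<close> by (simp add: bij_betw_def endo_inj_surj)
  qed
  show "t (i + l) (t (j + l) x) = t (j + l) (t (i + l) x)"
    if "1 \<le> i" "i + 2 \<le> j" "j < k" "x \<in> Y" for i j x
    using that assms(1,2) by (intro far) auto
  show "t (i + l) (t (i + 1 + l) (t (i + l) x)) = t (i + 1 + l) (t (i + l) (t (i + 1 + l) x))"
    if "1 \<le> i" "i + 1 < k" "x \<in> Y" for i x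
    using that assms(1,2) braid[of "i + l" x] by auto
qed

lemma transport:
  assumes h: "bij_betw h X Y"
  shows "braid_action n Y (\<lambda>i y. h (t i (inv_into X h y)))"
proof -
  have mem: "inv_into X h y \<in> X" if "y \<in> Y" for y
    using that h by (simp add: bij_betw_def inv_into_into)
  have inv: "inv_into X h (h x) = x" if "x \<in> X" for x
    using that h by (simp add: bij_betw_def)
  show ?thesis
  proof
    show "finite Y" using h finite bij_betw_finite by blast
    show "bij_betw (\<lambda>y. h (t i (inv_into X h y))) Y Y" if "1 \<le> i" "i < n" for i
      using bij_betw_trans[OF bij_betw_trans[OF bij_betw_inv_into[OF h] bij[OF that]] h]
      by (simp add: comp_def)
    show "h (t i (inv_into X h (h (t j (inv_into X h y))))) =
        h (t j (inv_into X h (h (t i (inv_into X h y)))))"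
      if "1 \<le> i" "i + 2 \<le> j" "j < n" "y \<in> Y" for i j y
      using that mem[of y] far[of i j "inv_into X h y"] by (simp add: inv)
    show "h (t i (inv_into X h (h (t (i + 1) (inv_into X h (h (t i (inv_into X h y)))))))) =
        h (t (i + 1) (inv_into X h (h (t i (inv_into X h (h (t (i + 1) (inv_into X h y))))))))"
      if "1 \<le> i" "i + 1 < n" "y \<in> Y" for i y
      using that mem[of y] braid[of i "inv_into X h y"] by (simp add: inv)
  qed
qed

text \<open>Permutations of at most two points commute, so neighbouring generators coincide.\<close>

lemma two_points:
  assumes "card X < 3" "3 \<le> n" "x \<in> X"
  shows "t 1 x = t 2 x"
proof -
  have "t 1 (t (1 + 1) x) = t (1 + 1) (t 1 x)" if "x \<in> X" for x
  proof -
    define a b where "a = t 1 x" and "b = t 2 x"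
    have ab: "a \<in> X" "b \<in> X" "t 1 a \<in> X" "t 1 b \<in> X" "t 2 a \<in> X" "t 2 b \<in> X"
      using assms(2) that by (auto simp: a_def b_def)
    \<comment> \<open>Commutation is obtained from pigeonhole: among any three points of
      \<open>X\<close> two coincide, and injectivity of \<open>t 1\<close> and \<open>t 2\<close>
      turns such coincidences into the required equation.\<close>
    have two: "u = v \<or> v = w \<or> u = w" if "u \<in> X" "v \<in> X" "w \<in> X" for u v w
    proof (rule ccontr)
      assume "\<not> (u = v \<or> v = w \<or> u = w)"
      then have "card {u, v, w} = 3" by simp
      moreover have "card {u, v, w} \<le> card X"
        using that by (intro card_mono finite) auto
      ultimately show False using assms(1) by simp
    qed
    have inj: "u = v" if "t i u = t i v" "i = 1 \<or> i = 2" "u \<in> X" "v \<in> X" for u v i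
      using that assms(2) by (auto dest: cancel)
    show ?thesis
      using ab two[of x a b] two[of x a "t 1 a"] two[of x b "t 2 b"] two[of x "t 2 a" a]
        two[of x b "t 1 b"] two[of a "t 2 a" "t 1 b"] inj[of 1] inj[of 2] that
      unfolding one_add_one a_def[symmetric] b_def[symmetric]
      by (metis a_def b_def)
  qed
  then show ?thesis
    using commuting_neighbours_eq[of 1 x] assms(2,3) by (simp add: numeral_2_eq_2)
qed

section \<open>The later generators acting on fixed points and orbits of \<open>t 1\<close>\<close>

lemma commute_powers:
  assumes "1 < n" "3 \<le> i" "i < n" "x \<in> X"
  shows "t i ((t 1 ^^ k) x) = (t 1 ^^ k) (t i x)"
  using assms far[of 1 i] by (intro funpow_commute_on[of _ X]) auto

lemma image_orbit:
  assumes "1 < n" "3 \<le> i" "i < n" "x \<in> X"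
  shows "t i ` orbit_of (t 1) x = orbit_of (t 1) (t i x)"
  using assms far[of 1 i] by (intro image_orbit_of[of _ X]) auto

text \<open>The nontrivial orbits are pairwise disjoint, consist of moved points and contain at
  least two points each. This bound is what makes the sets in the induction small enough.\<close>

lemma orbits_card:
  assumes "1 < n"
  shows "2 * card (orbit_of (t 1) ` {x \<in> X. t 1 x \<noteq> x}) + card {x \<in> X. t 1 x = x} \<le> card X"
proof -
  let ?S = "{x \<in> X. t 1 x \<noteq> x}" and ?F = "{x \<in> X. t 1 x = x}"
  let ?Y = "orbit_of (t 1) ` ?S"
  have b: "bij_betw (t 1) X X" using assms by (intro bij) auto
  have c: "t 1 ` X \<subseteq> X" using b by (simp add: bij_betw_def)
  have sub: "A \<subseteq> ?S" if A: "A \<in> ?Y" for A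
  proof
    fix y assume y: "y \<in> A"
    obtain x where x: "x \<in> X" "t 1 x \<noteq> x" "A = orbit_of (t 1) x" using A by blast
    have "y \<in> X" using orbit_of_subset[OF c x(1)] x y by auto
    moreover have "t 1 y \<noteq> y"
      using orbit_of_eq[OF finite b x(1), of y] orbit_of_fixed[of "t 1" y] x y
        orbit_of_self[of x "t 1"] by (metis singletonD)
    ultimately show "y \<in> ?S" by simp
  qed
  have two: "2 \<le> card A" if A: "A \<in> ?Y" for A
  proof -
    obtain x where x: "x \<in> X" "t 1 x \<noteq> x" "A = orbit_of (t 1) x" using A by blast
    have "card {x, t 1 x} \<le> card A"
      using sub[OF that] x orbit_of_step[of "t 1" x] finite by (intro card_mono) (auto intro: finite_subset)
    then show ?thesis using x(2) by simp
  qed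
  have "pairwise disjnt ?Y"
  proof (rule pairwiseI)
    fix P Q assume PQ: "P \<in> ?Y" "Q \<in> ?Y" "P \<noteq> Q"
    have eq: "orbit_of (t 1) y = A" if A: "A \<in> ?Y" "y \<in> A" for A y
    proof -
      obtain x where x: "x \<in> X" "A = orbit_of (t 1) x" using A(1) by blast
      show ?thesis
        using orbit_of_eq[OF finite b x(1), of y] A(2) unfolding x(2) by blast
    qed
    show "disjnt P Q"
      unfolding disjnt_iff
    proof (intro allI notI)
      fix y assume "y \<in> P \<and> y \<in> Q"
      then show False
        using eq[OF PQ(1), of y] eq[OF PQ(2), of y] PQ(3) by simp
    qed
  qed
  then have "card (\<Union> ?Y) = sum card ?Y"
    using sub finite by (intro card_Union_disjoint) (auto intro: finite_subset)
  also have "\<dots> \<ge> 2 * card ?Y"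
    using sum_bounded_below[of ?Y 2 card] two by (simp add: mult.commute)
  finally have "2 * card ?Y \<le> card (\<Union> ?Y)" .
  also have "\<dots> \<le> card ?S"
    using sub finite by (intro card_mono) auto
  finally have "2 * card ?Y \<le> card ?S" .
  moreover have "card ?S + card ?F = card (?S \<union> ?F)"
    using finite by (intro card_Un_disjoint[symmetric]) auto
  moreover have "?S \<union> ?F = X" by auto
  ultimately show ?thesis by simp
qed

text \<open>Each \<open>t i\<close> with \<open>3 \<le> i\<close> commutes with \<open>t 1\<close>
  and so permutes its nontrivial orbits. These generators, reindexed from 1, satisfy the relations
  of \<open>n - 2\<close> strands.\<close>

lemma orbit_action:
  assumes "5 \<le> n"
  shows "braid_action (n - 2) (orbit_of (t 1) ` {x \<in> X. t 1 x \<noteq> x}) (\<lambda>i A. t (i + 2) ` A)"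
    (is "braid_action _ ?Y _")
proof
  have c: "t 1 ` X \<subseteq> X" using assms by (intro image_subsetI closed) auto
  show fin: "finite ?Y" using finite by simp
  have sub: "A \<subseteq> X" if A: "A \<in> ?Y" for A using A orbit_of_subset[OF c] by auto
  show "bij_betw ((`) (t (i + 2))) ?Y ?Y" if i: "1 \<le> i" "i < n - 2" for i
  proof -
    have i2: "i + 2 < n" using i by simp
    have "inj_on (t (i + 2)) X"
      using bij[of "i + 2"] that by (simp add: bij_betw_def)
    moreover have "\<Union> ?Y \<subseteq> X" using sub by blast
    ultimately have "inj_on (t (i + 2)) (\<Union> ?Y)" by (rule inj_on_subset)
    then have "inj_on ((`) (t (i + 2))) ?Y" by (rule inj_on_image)
    moreover have "(`) (t (i + 2)) ` ?Y \<subseteq> ?Y"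
    proof clarify
      fix x assume x: "x \<in> X" "t 1 x \<noteq> x"
      have "t 1 (t (i + 2) x) \<noteq> t (i + 2) x"
        using far[of 1 "i + 2" x] cancel[of "i + 2" "t 1 x" x] x i i2 by auto
      then show "t (i + 2) ` orbit_of (t 1) x \<in> ?Y"
        using image_orbit[of "i + 2" x] x that by auto
    qed
    ultimately show ?thesis using fin by (simp add: bij_betw_def endo_inj_surj)
  qed
  show "t (i + 2) ` (t (j + 2) ` A) = t (j + 2) ` (t (i + 2) ` A)"
    if "1 \<le> i" "i + 2 \<le> j" "j < n - 2" "A \<in> ?Y" for i j A
    unfolding image_image using sub[OF that(4)] that far[of "i + 2" "j + 2"]
    by (intro image_cong) auto
  show "t (i + 2) ` (t (i + 1 + 2) ` (t (i + 2) ` A)) = t (i + 1 + 2) ` (t (i + 2) ` (t (i + 1 + 2) ` A))"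
    if "1 \<le> i" "i + 1 < n - 2" "A \<in> ?Y" for i A
    unfolding image_image using sub[OF that(3)] that braid[of "i + 2"]
    by (intro image_cong) auto
qed

lemma fixed_action:
  assumes "5 \<le> n"
  shows "braid_action (n - 2) {x \<in> X. t 1 x = x} (\<lambda>i. t (i + 2))"
proof (rule subaction)
  fix i assume "1 \<le> i" "i < n - 2"
  then show "t (i + 2) ` {x \<in> X. t 1 x = x} \<subseteq> {x \<in> X. t 1 x = x}"
    using far[of 1 "i + 2"] by auto
qed (use assms in auto)

text \<open>At a given \<open>x\<close>, both \<open>t 3\<close> and \<open>t 4\<close> differ from
  \<open>t 6\<close> by powers of \<open>t 1\<close>, with exponents depending on \<open>x\<close>.
  Since \<open>t 1\<close> and \<open>t 6\<close> commute with \<open>t 3\<close> and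
  \<open>t 4\<close>, both products of \<open>t 3\<close> and \<open>t 4\<close> send
  \<open>x\<close> to \<open>(t 1 ^^ (a + b)) (t 6 (t 6 x))\<close>. The bound on \<open>n\<close>
  makes \<open>t 6\<close> available.\<close>

lemma large_step:
  assumes n: "7 \<le> n" and x: "x \<in> X"
    and rel: "\<And>i j x. \<lbrakk>3 \<le> i; i < n; 3 \<le> j; j < n; x \<in> X\<rbrakk> \<Longrightarrow> t i x \<in> orbit_of (t 1) (t j x)"
  shows "t 3 x = t 4 x"
proof -
  have "t 3 (t (3 + 1) x) = t (3 + 1) (t 3 x)" if x: "x \<in> X" for x
  proof -
    obtain a b where a: "t 3 x = (t 1 ^^ a) (t 6 x)" and b: "t 4 x = (t 1 ^^ b) (t 6 x)"
      using rel[of 3 6 x] rel[of 4 6 x] x n unfolding orbit_of_def by auto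
    have "t 3 (t 4 x) = (t 1 ^^ b) (t 6 (t 3 x))"
      using b commute_powers[of 3 "t 6 x" b] far[of 3 6 x] that n by simp
    also have "\<dots> = (t 1 ^^ (b + a)) (t 6 (t 6 x))"
      using a commute_powers[of 6 "t 6 x" a] that n by (simp add: funpow_add)
    also have "\<dots> = (t 1 ^^ a) (t 6 (t 4 x))"
      using b commute_powers[of 6 "t 6 x" b] that n by (simp add: add.commute[of b] funpow_add)
    also have "\<dots> = t 4 (t 3 x)"
      using a commute_powers[of 4 "t 6 x" a] far[of 4 6 x] that n by simp
    finally show ?thesis by simp
  qed
  then show ?thesis
    using commuting_neighbours_eq[of 3 x] n x by simp
qed

section \<open>Criteria for all generators to act alike\<close>

definition const :: bool where
  "const \<longleftrightarrow> (\<forall>i j x. 1 \<le> i \<longrightarrow> i < n \<longrightarrow> 1 \<le> j \<longrightarrow> j < n \<longrightarrow> x \<in> X \<longrightarrow> t i x = t j x)"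

lemma constD: "\<lbrakk>const; 1 \<le> i; i < n; 1 \<le> j; j < n; x \<in> X\<rbrakk> \<Longrightarrow> t i x = t j x"
  unfolding const_def by blast

lemma const_if_neighbours_eq:
  assumes "1 \<le> i" "i + 1 < n" "\<And>x. x \<in> X \<Longrightarrow> t i x = t (i + 1) x"
  shows const
  unfolding const_def using neighbours_eq_imp_const[OF assms] by simp

text \<open>A generator adjacent to exactly one of \<open>t i\<close>, \<open>t j\<close> commutes
  with the other, hence with both, and equals its neighbour. If \<open>j\<close> is not
  \<open>i + 2\<close>, take index \<open>i + 1\<close>; otherwise take \<open>j + 1\<close> or
  \<open>i - 1\<close>, one of which is in range when \<open>5 \<le> n\<close>. For
  \<open>n = 4\<close> neither is, and the exceptional representation has
  \<open>t 1 = t 3\<close>.\<close>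

lemma const_if_far_eq:
  assumes n: "5 \<le> n" and ij: "1 \<le> i" "i + 2 \<le> j" "j < n"
    and eq: "\<And>x. x \<in> X \<Longrightarrow> t i x = t j x"
  shows const
proof (cases "j = i + 2")
  case False
  have "t i x = t (i + 1) x" if "x \<in> X" for x
    using ij False that eq far[of "i + 1" j] by (intro commuting_neighbours_eq) auto
  then show ?thesis using ij by (intro const_if_neighbours_eq) auto
next
  case j: True
  show ?thesis
  proof (cases "i + 3 < n")
    case True
    have "t (i + 2) x = t (i + 2 + 1) x" if "x \<in> X" for x
      using ij that True eq far[of i "i + 2 + 1"] unfolding j
      by (intro commuting_neighbours_eq) (auto simp: eval_nat_numeral)
    then show ?thesis using ij True by (intro const_if_neighbours_eq[of "i + 2"]) auto
  next
    case False
    then have "i = (i - 1) + 1" "1 \<le> i - 1" using n by auto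
    then obtain k where k: "i = k + 1" "1 \<le> k" by blast
    have "t k x = t (k + 1) x" if "x \<in> X" for x
      using ij that k eq far[of k j] j
      by (intro commuting_neighbours_eq) (auto simp: eval_nat_numeral)
    then show ?thesis using ij k by (intro const_if_neighbours_eq[of k]) auto
  qed
qed

text \<open>The product of \<open>t i\<close> and \<open>t (i + 1)\<close> conjugates
  \<open>t i\<close> to \<open>t (i + 1)\<close>. The point \<open>z\<close> is the preimage of
  \<open>x\<close> under this product.\<close>

lemma involution_propagates:
  assumes i: "1 \<le> i" "i + 1 < n" and inv: "\<And>x. x \<in> X \<Longrightarrow> t i (t i x) = x" and x: "x \<in> X"
  shows "t (i + 1) (t (i + 1) x) = x"
proof -
  obtain y where y: "y \<in> X" "x = t i y" using surjE[of i x] i x by auto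
  obtain z where z: "z \<in> X" "y = t (i + 1) z" using surjE[of "i + 1" y] i y by auto
  show ?thesis using braid[of i z] braid[of i "t i z"] inv[of z] i z unfolding y(2) z(2) by simp
qed

text \<open>By the braid relation \<open>?u\<close> intertwines \<open>t i\<close> with
  \<open>t (i + 1)\<close>, so it carries the moved points of the former onto those of the
  latter.\<close>

lemma card_moved_Suc:
  assumes i: "1 \<le> i" "i + 1 < n"
  shows "card {x \<in> X. t (i + 1) x \<noteq> x} = card {x \<in> X. t i x \<noteq> x}"
proof -
  let ?u = "\<lambda>x. t i (t (i + 1) x)"
  have b: "bij_betw ?u X X"
    using bij_betw_trans[OF bij bij, of "i + 1" i] i by (simp add: comp_def)
  have "?u ` {x \<in> X. t i x \<noteq> x} = {x \<in> X. t (i + 1) x \<noteq> x}"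
  proof (intro equalityI subsetI)
    fix y assume "y \<in> ?u ` {x \<in> X. t i x \<noteq> x}"
    then obtain x where x: "x \<in> X" "t i x \<noteq> x" "y = ?u x" by auto
    have "t (i + 1) y = ?u (t i x)" using braid[of i x] i x by simp
    then have "t (i + 1) y \<noteq> y"
      using x i by (auto dest!: cancel)
    then show "y \<in> {x \<in> X. t (i + 1) x \<noteq> x}" using x i by simp
  next
    fix y assume y: "y \<in> {x \<in> X. t (i + 1) x \<noteq> x}"
    then obtain x where x: "x \<in> X" "y = ?u x" using b by (auto simp: bij_betw_def image_iff)
    then have "t i x \<noteq> x" using braid[of i x] i y by auto
    then show "y \<in> ?u ` {x \<in> X. t i x \<noteq> x}" using x by auto
  qed
  moreover have "bij_betw ?u {x \<in> X. t i x \<noteq> x} (?u ` {x \<in> X. t i x \<noteq> x})"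
    by (rule bij_betw_subset[OF b]) auto
  ultimately show ?thesis by (simp add: bij_betw_same_card)
qed

lemma moved_closed:
  assumes "1 \<le> i" "i < n" "x \<in> X" "t i x \<noteq> x"
  shows "t i (t i x) \<noteq> t i x"
  using assms by (auto dest: cancel)

lemma card_moved:
  assumes "1 \<le> i" "i < n"
  shows "card {x \<in> X. t i x \<noteq> x} = card {x \<in> X. t 1 x \<noteq> x}"
  using assms by (induction i rule: dec_induct) (simp_all add: card_moved_Suc[simplified])

lemma const_if_trivial:
  assumes n: "3 \<le> n" and "\<And>x. x \<in> X \<Longrightarrow> t 1 x = x"
  shows const
proof (rule const_if_neighbours_eq[of 1])
  fix x assume x: "x \<in> X"
  have "card {x \<in> X. t 1 x \<noteq> x} = 0" using assms(2) by (subst card_eq_0_iff) auto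
  then have "card {x \<in> X. t 2 x \<noteq> x} = 0" using card_moved[of 2] n by simp
  then have "t 2 x = x" using x finite by auto
  then show "t 1 x = t (1 + 1) x" using assms(2) x by (simp add: numeral_2_eq_2)
qed (use n in auto)

text \<open>Here every generator is a transposition. As \<open>t j\<close> commutes with
  \<open>t i\<close>, it sends \<open>a\<close> to a point moved by \<open>t i\<close>, which must
  be \<open>b\<close>; thus both exchange \<open>a\<close> and \<open>b\<close>.\<close>

lemma far_transpositions_eq:
  assumes ij: "1 \<le> i" "i + 2 \<le> j" "j < n"
    and card: "card {x \<in> X. t 1 x \<noteq> x} = 2"
    and a: "a \<in> X" "t i a \<noteq> a" "t j a \<noteq> a" and x: "x \<in> X"
  shows "t i x = t j x"
proof -
  define b where "b = t i a"
  have i: "i < n" and j: "1 \<le> j" using ij by auto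
  have moved: "{x \<in> X. t k x \<noteq> x} = {a, c}"
    if "k = i \<or> k = j" "c \<in> X" "t k c \<noteq> c" "c \<noteq> a" for k c
  proof -
    have eq: "card {a, c} = card {x \<in> X. t k x \<noteq> x}"
      using card card_moved[of k] that ij by auto
    have sub: "{a, c} \<subseteq> {x \<in> X. t k x \<noteq> x}" using that a by auto
    show ?thesis using card_subset_eq[OF _ sub eq] finite by simp
  qed
  have Mi: "{x \<in> X. t i x \<noteq> x} = {a, b}"
    using moved[of i b] a ij moved_closed[of i a] by (simp add: b_def)
  have "t i (t j a) \<noteq> t j a" using far[of i j a] ij j a cancel[of j "t i a" a] by auto
  then have "t j a \<in> {x \<in> X. t i x \<noteq> x}" using a ij j by simp
  then have ja: "t j a = b" unfolding Mi using a by auto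
  have Mj: "{x \<in> X. t j x \<noteq> x} = {a, b}"
    using moved[of j b] a ij j ja moved_closed[of j a] unfolding b_def by simp
  have b: "b \<in> X" "t i b \<noteq> b" "t j b \<noteq> b" using Mi Mj by auto
  have "t i b \<in> {a, b}" unfolding Mi[symmetric] using b moved_closed[of i b] ij i by simp
  moreover have "t j b \<in> {a, b}" unfolding Mj[symmetric] using b moved_closed[of j b] ij j by simp
  ultimately have ba: "t i b = a" "t j b = a" using b by auto
  show ?thesis
  proof (cases "x = a \<or> x = b")
    case True
    then show ?thesis using ba ja by (auto simp: b_def)
  next
    case False
    then have "x \<notin> {x \<in> X. t i x \<noteq> x}" "x \<notin> {x \<in> X. t j x \<noteq> x}"
      unfolding Mi Mj by simp_all
    then show ?thesis using x by simp
  qed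
qed

text \<open>The transpositions \<open>t 1\<close>, \<open>t 3\<close>, \<open>t 5\<close> cannot
  have disjoint supports in fewer than six points, so two of them share a moved point and are
  equal.\<close>

lemma const_if_transpositions:
  assumes n: "6 \<le> n" and X: "card X < 6" and card: "card {x \<in> X. t 1 x \<noteq> x} = 2"
  shows const
proof -
  let ?M = "\<lambda>i. {x \<in> X. t i x \<noteq> x}"
  have c: "card (?M 1) = 2" "card (?M 3) = 2" "card (?M 5) = 2"
    using card card_moved[of 3] card_moved[of 5] n by auto
  have "\<exists>i j a. 1 \<le> i \<and> i + 2 \<le> j \<and> j < n \<and> a \<in> ?M i \<inter> ?M j"
  proof (rule ccontr)
    assume "\<not> ?thesis"
    then have no: "a \<notin> ?M i \<inter> ?M j" if "1 \<le> i" "i + 2 \<le> j" "j < n" for i j a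
      using that by blast
    have d: "?M 1 \<inter> ?M 3 = {}" "(?M 1 \<union> ?M 3) \<inter> ?M 5 = {}"
      using no[of 1 3] no[of 1 5] no[of 3 5] n by auto
    have "card (?M 1 \<union> ?M 3 \<union> ?M 5) = 6"
      using finite c d by (simp add: card_Un_disjoint)
    moreover have "card (?M 1 \<union> ?M 3 \<union> ?M 5) \<le> card X"
      using finite by (intro card_mono) auto
    ultimately show False using X by simp
  qed
  then obtain i j a where ij: "1 \<le> i" "i + 2 \<le> j" "j < n" and a: "a \<in> ?M i \<inter> ?M j" by blast
  show ?thesis
    using n far_transpositions_eq[OF ij card, of a] a by (intro const_if_far_eq[OF _ ij]) auto
qed

text \<open>
  If \<open>t 3\<close> and \<open>t 4\<close> are involutions, then \<open>p = t 3 \<circ> t 4\<close> satisfies \<open>p\<^sup>3 = 1\<close>, while \<open>p\<close> agrees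
  with a power of the involution \<open>t 1\<close> on each orbit, so that \<open>p\<^sup>2 = 1\<close>.
\<close>

lemma involution_step:
  assumes n: "5 \<le> n" and inv: "\<And>x. x \<in> X \<Longrightarrow> t 1 (t 1 x) = x"
    and rel: "\<And>x. x \<in> X \<Longrightarrow> t 3 x \<in> orbit_of (t 1) (t 4 x)" and x: "x \<in> X"
  shows "t 3 x = t 4 x"
proof -
  have i2: "t 2 (t 2 y) = y" if "y \<in> X" for y
    using involution_propagates[of 1 y] that inv n by (simp add: numeral_2_eq_2)
  have i3: "t 3 (t 3 y) = y" if "y \<in> X" for y
    using involution_propagates[of 2 y] that i2 n by simp
  have i4: "t 4 (t 4 y) = y" if "y \<in> X" for y
    using involution_propagates[of 3 y] that i3 n by simp
  define w where "w = t 4 x"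
  have w: "w \<in> X" using x n by (simp add: w_def)
  have "(t 1 ^^ k) w = w \<or> (t 1 ^^ k) w = t 1 w" for k
    by (induction k) (use inv[OF w] in auto)
  moreover obtain k where "t 3 x = (t 1 ^^ k) w"
    using rel[OF x] unfolding orbit_of_def w_def[symmetric] by blast
  ultimately consider "t 3 x = w" | "t 3 x = t 1 w" by metis
  then show ?thesis
  proof cases
    case 2
    have pw: "t 3 (t 4 w) = t 1 w" using 2 i4[OF x] by (simp add: w_def)
    have "t 3 (t 4 (t 1 w)) = t 1 (t 3 (t 4 w))"
      using far[of 1 3 "t 4 w"] far[of 1 4 w] n w by simp
    then have ppw: "t 3 (t 4 (t 1 w)) = w" using pw inv w by simp
    have "t 4 (t 3 (t 4 w)) = t 3 (t 4 (t 3 w))" using braid[of 3 w] n w by simp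
    \<comment> \<open>The left side is \<open>p\<close> applied three times to \<open>w\<close>.
      Since \<open>p\<close> exchanges \<open>w\<close> and \<open>t 1 w\<close>, it equals
      \<open>t 1 w\<close>, while the braid relation makes it \<open>w\<close>.\<close>
    then have "t 3 (t 4 (t 3 (t 4 (t 3 (t 4 w))))) = t 3 (t 4 (t 3 (t 3 (t 4 (t 3 w)))))" by simp
    also have "\<dots> = w" using i3 i4 n w by simp
    finally have "t 1 w = w" using pw ppw by simp
    then show ?thesis using 2 w_def by simp
  qed (simp add: w_def)
qed

text \<open>
  An orbit of \<open>t 1\<close> with at least three of the at most five points is preserved by \<open>t 3\<close> and \<open>t 4\<close>,
  which therefore act on it as powers of \<open>t 1\<close>; at most two points remain.
\<close>

lemma long_orbit_step:
  assumes n: "5 \<le> n" and X: "card X < 6" and x0: "x0 \<in> X" "t 1 (t 1 x0) \<noteq> x0" and x: "x \<in> X"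
  shows "t 3 x = t 4 x"
proof -
  let ?B = "orbit_of (t 1) x0"
  have b: "bij_betw (t 1) X X" using n by (intro bij) auto
  have B: "?B \<subseteq> X" using b x0 by (intro orbit_of_subset) (auto simp: bij_betw_def)
  have finB: "Finite_Set.finite ?B" using finite_subset[OF B finite] .
  have "card {x0, t 1 x0, t 1 (t 1 x0)} = 3"
  proof -
    have "t 1 x0 \<noteq> x0" using x0 by auto
    then show ?thesis using x0 moved_closed[of 1 x0] n by auto
  qed
  moreover have "{x0, t 1 x0, t 1 (t 1 x0)} \<subseteq> ?B"
    using orbit_of_step[of "t 1"] orbit_of_trans[OF orbit_of_step orbit_of_step, of "t 1"] by simp
  ultimately have card: "3 \<le> card ?B" using finB by (metis card_mono)
  \<comment> \<open>The image is again an orbit of \<open>t 1\<close> of the same size. Two disjoint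
    sets of at least three points do not fit into \<open>X\<close>, so the image meets
    \<open>?B\<close> and therefore equals it.\<close>
  have preserved: "t i ` ?B = ?B" if i: "3 \<le> i" "i < n" for i
  proof -
    have eq: "t i ` ?B = orbit_of (t 1) (t i x0)" using image_orbit i n x0 by simp
    have "inj_on (t i) ?B"
      using bij[of i] B i by (auto simp: bij_betw_def intro: inj_on_subset)
    then have "card (t i ` ?B) = card ?B" by (rule card_image)
    moreover have sub: "t i ` ?B \<union> ?B \<subseteq> X" using B i by auto
    then have "card (t i ` ?B \<union> ?B) \<le> card X" using finite by (intro card_mono)
    ultimately have "t i ` ?B \<inter> ?B \<noteq> {}"
      using card X card_Un_disjoint[of "t i ` ?B" ?B] finB by auto
    then obtain y where y: "y \<in> orbit_of (t 1) (t i x0)" "y \<in> ?B" using eq by auto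
    have "t i x0 \<in> X" using x0 i by simp
    then show ?thesis
      unfolding eq using orbit_of_eq[OF finite b _ y(1)] orbit_of_eq[OF finite b x0(1) y(2)] by simp
  qed
  have preserved_compl: "t i ` (X - ?B) \<subseteq> X - ?B" if i: "3 \<le> i" "i < n" for i
  proof
    fix y assume "y \<in> t i ` (X - ?B)"
    then obtain z where z: "z \<in> X" "z \<notin> ?B" "y = t i z" by auto
    have "y \<notin> t i ` ?B" using z B i by (auto dest: cancel)
    then show "y \<in> X - ?B" using preserved[OF i] z i by simp
  qed
  interpret C: braid_action 3 "X - ?B" "\<lambda>i. t (i + 2)"
    using n preserved_compl by (intro subaction) auto
  have "card (X - ?B) < 3" using card X finB B by (simp add: card_Diff_subset)
  then have compl: "t 3 y = t 4 y" if "y \<in> X - ?B" for y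
    using C.two_points[of y] that by (simp add: eval_nat_numeral)
  have "t 3 (t (3 + 1) y) = t (3 + 1) (t 3 y)" if y: "y \<in> X" for y
  proof (cases "y \<in> ?B")
    case True
    have "t 3 y \<in> orbit_of (t 1) y" "t 4 y \<in> orbit_of (t 1) y"
      using preserved[of 3] preserved[of 4] n True orbit_of_eq[OF finite b x0(1) True] by auto
    then obtain k l where kl: "t 3 y = (t 1 ^^ k) y" "t 4 y = (t 1 ^^ l) y"
      unfolding orbit_of_def by auto
    have "t 3 (t 4 y) = (t 1 ^^ (l + k)) y"
      using commute_powers[of 3 y l] n y unfolding kl(2) funpow_funpow[symmetric] kl(1)[symmetric]
      by simp
    moreover have "t 4 (t 3 y) = (t 1 ^^ (k + l)) y"
      using commute_powers[of 4 y k] n y unfolding kl(1) funpow_funpow[symmetric] kl(2)[symmetric]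
      by simp
    ultimately show ?thesis by (simp add: add.commute)
  next
    case False
    then have "y \<in> X - ?B" "t 3 y \<in> X - ?B" using preserved_compl[of 3] n y by auto
    then show ?thesis using compl[of y] compl[of "t 3 y"] by simp
  qed
  then show ?thesis using commuting_neighbours_eq[of 3 x] n x by simp
qed

section \<open>Artin's theorem: base cases and induction\<close>

lemma agree_imp_same_orbit:
  assumes n: "5 \<le> n" and ij: "3 \<le> i" "i < n" "3 \<le> j" "j < n" and x: "x \<in> X"
    and fixed: "t 1 x = x \<Longrightarrow> t i x = t j x"
    and orbits: "t 1 x \<noteq> x \<Longrightarrow> t i ` orbit_of (t 1) x = t j ` orbit_of (t 1) x"
  shows "t i x \<in> orbit_of (t 1) (t j x)"
proof (cases "t 1 x = x")
  case True
  then show ?thesis using fixed by simp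
next
  case False
  then have "orbit_of (t 1) (t i x) = orbit_of (t 1) (t j x)"
    using orbits image_orbit n ij x by simp
  then show ?thesis using orbit_of_self by metis
qed

text \<open>If \<open>t 1\<close> is not an involution, it has an orbit of at least three points. If
  it is a nontrivial involution with at most two fixed points, it also has at most two nontrivial
  orbits, so \<open>t 3\<close> and \<open>t 4\<close> agree on both sets. With three or more fixed
  points, counting forces \<open>n = 6\<close> and a transposition.\<close>

lemma const_small:
  assumes n: "n = 5 \<or> n = 6" and X: "card X < n"
  shows const
proof (cases "\<forall>x\<in>X. t 1 (t 1 x) = x")
  case False
  then obtain x0 where "x0 \<in> X" "t 1 (t 1 x0) \<noteq> x0" by blast
  then show ?thesis
    using long_orbit_step[of x0] n X by (intro const_if_neighbours_eq[of 3]) auto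
next
  case inv: True
  let ?F = "{x \<in> X. t 1 x = x}" and ?S = "{x \<in> X. t 1 x \<noteq> x}"
  have "card (?F \<union> ?S) = card ?F + card ?S"
    using finite by (intro card_Un_disjoint) auto
  moreover have "?F \<union> ?S = X" by auto
  ultimately have FS: "card X = card ?F + card ?S" by simp
  consider "?S = {}" | x where "x \<in> ?S" "card ?F < 3" | x where "x \<in> ?S" "card ?F \<ge> 3"
    by force
  then show ?thesis
  proof cases
    case 1
    then show ?thesis using n by (intro const_if_trivial) auto
  next
    case 3
    have "card {x, t 1 x} \<le> card ?S"
      using 3 finite moved_closed[of 1 x] n by (intro card_mono) auto
    then have "card ?S = 2" "n = 6" using 3 FS n X by auto
    then show ?thesis using X by (intro const_if_transpositions) auto
  next
    case 2
    interpret F: braid_action "n - 2" ?F "\<lambda>i. t (i + 2)"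
      using n by (intro fixed_action) auto
    interpret Y: braid_action "n - 2" "orbit_of (t 1) ` ?S" "\<lambda>i A. t (i + 2) ` A"
      using n by (intro orbit_action) auto
    have n3: "3 \<le> n - 2" using n by auto
    have Y: "card (orbit_of (t 1) ` ?S) < 3" using orbits_card n X by auto
    have "t 3 x \<in> orbit_of (t 1) (t 4 x)" if x: "x \<in> X" for x
    proof (rule agree_imp_same_orbit)
      show "t 3 x = t 4 x" if "t 1 x = x"
        using F.two_points[of x] that 2 n3 x by (simp add: eval_nat_numeral)
      show "t 3 ` orbit_of (t 1) x = t 4 ` orbit_of (t 1) x" if "t 1 x \<noteq> x"
        using Y.two_points[OF Y, of "orbit_of (t 1) x"] that n3 x by (auto simp: eval_nat_numeral)
    qed (use n x in auto)
    then have "t 3 x = t (3 + 1) x" if "x \<in> X" for x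
      using involution_step[of x] that inv n by auto
    then show ?thesis using n by (intro const_if_neighbours_eq[of 3]) auto
  qed
qed

text \<open>
  The induction for Artin's theorem passes from points to orbits, that is, to sets of points;
  re-encoding a finite set by natural numbers keeps the type fixed.
\<close>

lemma const_transport:
  assumes "\<And>(Z :: nat set) u. \<lbrakk>braid_action n Z u; card Z = card X\<rbrakk> \<Longrightarrow> braid_action.const n Z u"
  shows const
proof -
  obtain h where h: "bij_betw h X {0..<card X}"
    using ex_bij_betw_finite_nat[OF finite] by blast
  interpret Z: braid_action n "{0..<card X}" "\<lambda>i y. h (t i (inv_into X h y))"
    using transport[OF h] .
  have Z: "Z.const" by (rule assms) (auto intro: Z.braid_action_axioms)
  show ?thesis
    unfolding const_def
  proof (intro allI impI)
    fix i j x assume ij: "1 \<le> i" "i < n" "1 \<le> j" "j < n" and x: "x \<in> X"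
    have "h (t i x) = h (t j x)"
      using Z.constD[OF Z ij, of "h x"] bij_betw_apply[OF h x] h x
      by (simp add: bij_betw_def)
    moreover have "inj_on h X" using h by (simp add: bij_betw_def)
    ultimately show "t i x = t j x" using ij x by (auto dest: inj_onD)
  qed
qed

lemma const_large:
  assumes n: "7 \<le> n" and X: "card X < n"
    and IH: "\<And>(Z :: nat set) u. \<lbrakk>braid_action (n - 2) Z u; card Z < n - 2\<rbrakk> \<Longrightarrow>
      braid_action.const (n - 2) Z u"
  shows const
proof (cases "{x \<in> X. t 1 x \<noteq> x} = {}")
  case True
  then show ?thesis using n by (intro const_if_trivial) auto
next
  case False
  let ?F = "{x \<in> X. t 1 x = x}" and ?S = "{x \<in> X. t 1 x \<noteq> x}"
  interpret F: braid_action "n - 2" ?F "\<lambda>i. t (i + 2)"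
    using n by (intro fixed_action) auto
  interpret Y: braid_action "n - 2" "orbit_of (t 1) ` ?S" "\<lambda>i A. t (i + 2) ` A"
    using n by (intro orbit_action) auto
  have "card (orbit_of (t 1) ` ?S) > 0" using False Y.finite by (simp add: card_gt_0_iff)
  \<comment> \<open>A nontrivial orbit exists and takes two points, so there are fewer than
    \<open>n - 2\<close> fixed points. The number of orbits is below \<open>n / 2\<close>, which is
    less than \<open>n - 2\<close>.\<close>
  then have cards: "card (orbit_of (t 1) ` ?S) < n - 2" "card ?F < n - 2"
    using orbits_card n X by auto
  have F: F.const using cards by (intro F.const_transport IH) auto
  have Y: Y.const using cards by (intro Y.const_transport IH) auto
  have rel: "t i x \<in> orbit_of (t 1) (t j x)"
    if ij: "3 \<le> i" "i < n" "3 \<le> j" "j < n" and x: "x \<in> X" for i j x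
  proof (rule agree_imp_same_orbit)
    have ij': "i - 2 + 2 = i" "j - 2 + 2 = j" using ij by auto
    show "t i x = t j x" if "t 1 x = x"
      using F.constD[OF F, of "i - 2" "j - 2" x] that ij x unfolding ij' by auto
    show "t i ` orbit_of (t 1) x = t j ` orbit_of (t 1) x" if "t 1 x \<noteq> x"
      using Y.constD[OF Y, of "i - 2" "j - 2" "orbit_of (t 1) x"] that ij x unfolding ij' by auto
  qed (use n ij x in auto)
  show ?thesis
  proof (rule const_if_neighbours_eq[of 3])
    fix x assume "x \<in> X"
    from large_step[OF n this rel] show "t 3 x = t (3 + 1) x" by simp
  qed (use n in auto)
qed

end

text \<open>The induction descends by two strands, so both 5 and 6 serve as base cases.\<close>

lemma braid_action_const_nat:
  fixes X :: "nat set"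
  assumes "braid_action n X t" "card X < n" "5 \<le> n"
  shows "braid_action.const n X t"
  using assms
proof (induction n arbitrary: X t rule: less_induct)
  case (less n)
  interpret braid_action n X t by fact
  show ?case
  proof (cases "7 \<le> n")
    case True
    then have "n - 2 < n" "5 \<le> n - 2" by auto
    then show ?thesis
      by (intro const_large[OF True less.prems(2)] less.IH)
  next
    case False
    then show ?thesis using less.prems(2,3) by (intro const_small) auto
  qed
qed

text \<open>Four strands are excluded because their braid group maps onto the symmetric group on
  three letters with distinct images of neighbouring generators.\<close>

lemma (in braid_action) Artin:
  assumes "card X < n" "n = 3 \<or> 5 \<le> n"
  shows const
proof (cases "n = 3")
  case True
  then have "t 1 x = t (1 + 1) x" if "x \<in> X" for x
    using two_points[of x] that assms(1) by (simp add: numeral_2_eq_2)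
  then show ?thesis using True by (intro const_if_neighbours_eq[of 1]) auto
next
  case False
  then show ?thesis
    using assms by (intro const_transport braid_action_const_nat) auto
qed

section \<open>Homomorphisms from a presented group\<close>

definition word_val :: "('b, 'c) monoid_scheme \<Rightarrow> ('x \<Rightarrow> 'b) \<Rightarrow> 'x word \<Rightarrow> 'b" where
  "word_val H f w = foldr (\<lambda>(x, e) r. (if e then f x else inv\<^bsub>H\<^esub> (f x)) \<otimes>\<^bsub>H\<^esub> r) w \<one>\<^bsub>H\<^esub>"

lemma word_val_Nil [simp]: "word_val H f [] = \<one>\<^bsub>H\<^esub>"
  by (simp add: word_val_def)

lemma word_val_Cons [simp]:
  "word_val H f ((x, e) # w) = (if e then f x else inv\<^bsub>H\<^esub> (f x)) \<otimes>\<^bsub>H\<^esub> word_val H f w"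
  by (simp add: word_val_def)

lemma word_val_closed:
  assumes "group H" "f \<in> X \<rightarrow> carrier H" "w \<in> words X"
  shows "word_val H f w \<in> carrier H"
proof -
  interpret group H by fact
  show ?thesis using assms(2,3) by (induction w) (auto simp: Pi_iff)
qed

lemma word_val_append:
  assumes "group H" "f \<in> X \<rightarrow> carrier H" "u \<in> words X" "v \<in> words X"
  shows "word_val H f (u @ v) = word_val H f u \<otimes>\<^bsub>H\<^esub> word_val H f v"
proof -
  interpret group H by fact
  have "word_val H f v \<in> carrier H" using assms by (intro word_val_closed)
  then show ?thesis using assms(2,3)
  proof (induction u)
    case (Cons l u)
    obtain x e where l: "l = (x, e)" by (cases l)
    have "f x \<in> carrier H" "word_val H f u \<in> carrier H"
      using Cons.prems l word_val_closed[OF assms(1,2), of u] by auto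
    then show ?case using Cons l by (simp add: m_assoc)
  qed simp
qed

lemma word_val_pres_eq:
  assumes H: "group H" and f: "f \<in> X \<rightarrow> carrier H"
    and rels: "\<And>u v. \<lbrakk>(u, v) \<in> R; u \<in> words X; v \<in> words X\<rbrakk> \<Longrightarrow> word_val H f u = word_val H f v"
    and uv: "(u, v) \<in> pres_eq X R"
  shows "word_val H f u = word_val H f v"
proof -
  interpret group H by fact
  note app = word_val_append[OF H f] and closed = word_val_closed[OF H f]
  have step: "word_val H f u = word_val H f v" if "pres_step X R u v" for u v
    using that
  proof cases
    case (cancel p q x e)
    then have "f x \<in> carrier H" "word_val H f q \<in> carrier H" using f closed by auto
    then have "word_val H f ([(x, e), (x, \<not> e)] @ q) = word_val H f q"
      by (simp add: m_assoc[symmetric])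
    then show ?thesis using cancel app by (metis words_simps append_Cons append_Nil fst_conv)
  next
    case (rel p q u' v')
    then show ?thesis using app rels by simp
  qed
  have "equivclp (pres_step X R) u v" using uv by (simp add: pres_eq_def)
  then show ?thesis
    by (induction rule: equivclp_induct) (auto dest: step)
qed

text \<open>Universal property of a presentation: evaluation of words respects cancellation and the
  relations, so it descends to classes.\<close>

lemma presented_group_lift:
  assumes H: "group H" and f: "f \<in> X \<rightarrow> carrier H"
    and rels: "\<And>u v. \<lbrakk>(u, v) \<in> R; u \<in> words X; v \<in> words X\<rbrakk> \<Longrightarrow> word_val H f u = word_val H f v"
  obtains \<rho> where "\<rho> \<in> hom (presented_group X R) H" "\<And>x. x \<in> X \<Longrightarrow> \<rho> (pres_gen X R x) = f x"
proof
  let ?E = "pres_eq X R"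
  \<comment> \<open>Any representative may be chosen, since by \<open>word_val_pres_eq\<close> the
    value depends only on the class.\<close>
  define \<rho> where "\<rho> U = word_val H f (SOME u. u \<in> U)" for U
  interpret group H by fact
  have \<rho>: "\<rho> (?E `` {u}) = word_val H f u" if "u \<in> words X" for u
  proof -
    have "u \<in> ?E `` {u}" using that by (rule equiv_class_self[OF equiv_pres_eq])
    then have "(SOME u'. u' \<in> ?E `` {u}) \<in> ?E `` {u}" by (rule someI)
    then have "(u, SOME u'. u' \<in> ?E `` {u}) \<in> ?E" by simp
    from word_val_pres_eq[OF H f rels this] show ?thesis by (simp add: \<rho>_def)
  qed
  show "\<rho> \<in> hom (presented_group X R) H"
  proof (rule homI)
    fix U assume "U \<in> carrier (presented_group X R)"
    then obtain u where u: "u \<in> words X" "U = ?E `` {u}"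
      by (auto simp: presented_group_def elim: quotientE)
    show "\<rho> U \<in> carrier H" using u \<rho> word_val_closed[OF H f] by simp
    fix V assume "V \<in> carrier (presented_group X R)"
    then obtain v where v: "v \<in> words X" "V = ?E `` {v}"
      by (auto simp: presented_group_def elim: quotientE)
    show "\<rho> (U \<otimes>\<^bsub>presented_group X R\<^esub> V) = \<rho> U \<otimes>\<^bsub>H\<^esub> \<rho> V"
      using u v \<rho> word_val_append[OF H f] by (simp add: presented_group_mult)
  qed
  fix x assume "x \<in> X"
  then show "\<rho> (pres_gen X R x) = f x"
    using f \<rho>[of "[(x, True)]"] by (auto simp: pres_gen_def Pi_iff)
qed

lemma pres_gen_closed: "x \<in> X \<Longrightarrow> pres_gen X R x \<in> carrier (presented_group X R)"
  by (simp add: pres_gen_def presented_group_def quotientI)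

lemma presented_group_hom_word:
  assumes H: "group H" and \<rho>: "\<rho> \<in> hom (presented_group X R) H" and w: "w \<in> words X"
  shows "\<rho> (pres_eq X R `` {w}) = word_val H (\<lambda>x. \<rho> (pres_gen X R x)) w"
proof -
  let ?G = "presented_group X R" and ?E = "pres_eq X R"
  interpret G: group ?G by (rule group_presented_group)
  interpret H: group H by fact
  interpret group_hom ?G H \<rho> using \<rho> by unfold_locales
  have word_class_closed: "?E `` {w} \<in> carrier ?G" if "w \<in> words X" for w
    using that by (simp add: presented_group_def quotientI)
  show ?thesis using w
  proof (induction w)
    case Nil
    have "?E `` {[]} = \<one>\<^bsub>?G\<^esub>" by (simp add: presented_group_def)
    then show ?case by simp
  next
    case (Cons l w)
    obtain x e where l: "l = (x, e)" by (cases l)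
    have x: "x \<in> X" and w: "w \<in> words X" using Cons.prems l by auto
    have letter: "?E `` {[(x, e)]} = (if e then pres_gen X R x else inv\<^bsub>?G\<^esub> pres_gen X R x)"
    proof (cases e)
      case False
      have "?E `` {[(x, False)]} \<otimes>\<^bsub>?G\<^esub> pres_gen X R x = ?E `` {[(x, False), (x, True)]}"
        using x by (simp add: pres_gen_def presented_group_mult)
      also have "\<dots> = \<one>\<^bsub>?G\<^esub>"
        using pres_eq_inverse(2)[of "[(x, True)]" X R] x
        by (auto simp: presented_group_def intro!: equiv_class_eq[OF equiv_pres_eq])
      finally show ?thesis
        using x False pres_gen_closed[OF x, of R] G.inv_equality[of "?E `` {[(x, False)]}" "pres_gen X R x"]
        by (simp add: word_class_closed)
    qed (simp add: pres_gen_def)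
    have "\<rho> (?E `` {l # w}) = \<rho> (?E `` {[(x, e)]} \<otimes>\<^bsub>?G\<^esub> ?E `` {w})"
      using x w l by (simp add: presented_group_mult)
    also have "\<dots> = \<rho> (?E `` {[(x, e)]}) \<otimes>\<^bsub>H\<^esub> \<rho> (?E `` {w})"
      using x w by (intro hom_mult word_class_closed) auto
    also have "\<rho> (?E `` {[(x, e)]}) = (if e then \<rho> (pres_gen X R x) else inv\<^bsub>H\<^esub> \<rho> (pres_gen X R x))"
      using letter pres_gen_closed[OF x] by simp
    finally show ?case using Cons l w by simp
  qed
qed

lemma presented_group_relation:
  assumes "group H" "\<rho> \<in> hom (presented_group X R) H"
    and uv: "(u, v) \<in> R" "u \<in> words X" "v \<in> words X"
  shows "word_val H (\<lambda>x. \<rho> (pres_gen X R x)) u = word_val H (\<lambda>x. \<rho> (pres_gen X R x)) v"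
proof -
  have "pres_step X R u v" using pres_step.rel[of "[]" X "[]" u v R] uv by simp
  then have "(u, v) \<in> pres_eq X R" using uv by (auto simp: pres_eq_def)
  then have "pres_eq X R `` {u} = pres_eq X R `` {v}" by (rule equiv_class_eq[OF equiv_pres_eq])
  then show ?thesis using presented_group_hom_word[OF assms(1,2)] uv by metis
qed

text \<open>Every element of the image is the value of a word, so a property can be proved by
  prepending one signed letter at a time.\<close>

lemma presented_group_hom_induct:
  assumes H: "group H" and \<rho>: "\<rho> \<in> hom (presented_group X R) H"
    and g: "g \<in> \<rho> ` carrier (presented_group X R)"
    and one: "P \<one>\<^bsub>H\<^esub>"
    and mult: "\<And>x h. \<lbrakk>x \<in> X; h \<in> carrier H; P h\<rbrakk> \<Longrightarrow> P (\<rho> (pres_gen X R x) \<otimes>\<^bsub>H\<^esub> h)"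
    and inv: "\<And>x h. \<lbrakk>x \<in> X; h \<in> carrier H; P h\<rbrakk> \<Longrightarrow> P (inv\<^bsub>H\<^esub> \<rho> (pres_gen X R x) \<otimes>\<^bsub>H\<^esub> h)"
  shows "P g"
proof -
  let ?f = "\<lambda>x. \<rho> (pres_gen X R x)"
  have f: "?f \<in> X \<rightarrow> carrier H"
    using \<rho> pres_gen_closed[of _ X R] by (auto simp: hom_def)
  obtain w where w: "w \<in> words X" "g = \<rho> (pres_eq X R `` {w})"
    using g by (auto simp: presented_group_def elim: quotientE)
  have "P (word_val H ?f w)" using w(1)
  proof (induction w)
    case (Cons l w)
    then show ?case
      using mult inv word_val_closed[OF H f, of w] by (cases l) auto
  qed (simp add: one)
  then show ?thesis using presented_group_hom_word[OF H \<rho> w(1)] w(2) by simp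
qed

section \<open>Central elements of primitive permutation groups\<close>

lemma commute_funpow: "g \<circ> f = f \<circ> g \<Longrightarrow> g \<circ> (f ^^ k) = (f ^^ k) \<circ> g"
  by (induction k) (simp_all add: fun_eq_iff)

text \<open>Each \<open>g\<close> carries the orbit of \<open>z\<close> onto the orbit of
  \<open>g z\<close>, so the orbits form an invariant partition. If all blocks were singletons,
  \<open>y\<close> would be the identity.\<close>

lemma central_orbit:
  assumes G: "G \<subseteq> {p. p permutes {1..m}}"
    and prim: "\<And>P. invariant_partition m G P \<Longrightarrow> P = {{1..m}} \<or> P = (\<lambda>k. {k}) ` {1..m}"
    and y: "y permutes {1..m}" "y \<noteq> id" and central: "\<And>g. g \<in> G \<Longrightarrow> g \<circ> y = y \<circ> g"
    and x: "x \<in> {1..m}"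
  shows "orbit_of y x = {1..m}"
proof -
  let ?P = "orbit_of y ` {1..m}"
  have b: "bij_betw y {1..m} {1..m}" using y(1) by (rule permutes_imp_bij)
  have sub: "orbit_of y z \<subseteq> {1..m}" if "z \<in> {1..m}" for z
    using orbit_of_subset[of y "{1..m}" z] b that by (simp add: bij_betw_def)
  have eq: "orbit_of y w = A" if A: "A \<in> ?P" "w \<in> A" for A w
  proof -
    obtain z where z: "z \<in> {1..m}" "A = orbit_of y z" using A(1) by blast
    then show ?thesis using orbit_of_eq[OF _ b z(1), of w] A(2) by simp
  qed
  have "partition_on {1..m} ?P"
  proof (rule partition_onI)
    show "\<Union> ?P = {1..m}"
    proof
      show "\<Union> ?P \<subseteq> {1..m}" using sub by (rule UN_least)
      show "{1..m} \<subseteq> \<Union> ?P"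
      proof
        fix w assume "w \<in> {1..m}"
        then show "w \<in> \<Union> ?P" by (intro UN_I[of w]) simp_all
      qed
    qed
    show "disjnt A B" if AB: "A \<in> ?P" "B \<in> ?P" "A \<noteq> B" for A B
      unfolding disjnt_iff
    proof (intro allI notI)
      fix w assume "w \<in> A \<and> w \<in> B"
      then show False using eq[OF AB(1), of w] eq[OF AB(2), of w] AB(3) by simp
    qed
    show "{} \<notin> ?P"
    proof
      assume "{} \<in> ?P"
      then obtain z where "orbit_of y z = {}" by fastforce
      then show False using orbit_of_self[of z y] by blast
    qed
  qed
  moreover have "g ` A \<in> ?P" if g: "g \<in> G" and A: "A \<in> ?P" for g A
  proof -
    obtain z where z: "z \<in> {1..m}" "A = orbit_of y z" using A by blast
    have "g (y w) = y (g w)" for w using central[OF g] by (metis comp_apply)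
    then have "g ` A = orbit_of y (g z)"
      unfolding z(2) using image_orbit_of[of y UNIV g z] by simp
    moreover have "g permutes {1..m}" using g G by auto
    ultimately show ?thesis using z(1) permutes_in_image[of g "{1..m}" z] by blast
  qed
  ultimately have "invariant_partition m G ?P"
    unfolding invariant_partition_def by blast
  then consider "?P = {{1..m}}" | "?P = (\<lambda>k. {k}) ` {1..m}" using prim by blast
  then show ?thesis
  proof cases
    case 1
    have "orbit_of y x \<in> ?P" using x by (rule imageI)
    then show ?thesis unfolding 1 by simp
  next
    case 2
    have "y w = w" for w
    proof (cases "w \<in> {1..m}")
      case True
      then have "orbit_of y w \<in> ?P" by (rule imageI)
      then obtain k where "orbit_of y w = {k}" unfolding 2 by blast
      then show ?thesis using orbit_of_self[of w y] orbit_of_step[of y w] by auto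
    qed (use y(1) in \<open>auto simp: permutes_def\<close>)
    then show ?thesis using y(2) by auto
  qed
qed

lemma central_element:
  assumes m: "2 \<le> m" and G: "G \<subseteq> {p. p permutes {1..m}}"
    and prim: "\<And>P. invariant_partition m G P \<Longrightarrow> P = {{1..m}} \<or> P = (\<lambda>k. {k}) ` {1..m}"
    and z: "z permutes {1..m}" "z \<noteq> id" and central: "\<And>g. g \<in> G \<Longrightarrow> g \<circ> z = z \<circ> g"
  shows "prime m" "is_full_cycle m z" "\<And>g. g \<in> G \<Longrightarrow> \<exists>k. g = z ^^ k"
proof -
  have one: "1 \<in> {1..m}" using m by simp
  have orb: "orbit_of (z ^^ d) 1 = {1..m}" if "z ^^ d \<noteq> id" for d
    using commute_funpow[OF central] one permutes_funpow[OF z(1)] that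
    by (intro central_orbit[OF G prim]) auto
  have orb1: "orbit_of z 1 = {1..m}" using orb[of 1] z(2) by simp
  have perm: "permutation z" using z(1) permutation_permutes by blast
  \<comment> \<open>The list \<open>support z 1\<close> consists of the iterates of 1 up to the
    first return, so its length is the period of 1.\<close>
  have set: "set (support z 1) = {1..m}"
    using support_set[OF perm, of 1] orb1 by (simp add: orbit_of_def)
  have cyc: "cycle (support z 1)" using perm by (rule cycle_of_permutation)
  have lp: "least_power z 1 = m"
    using distinct_card[OF cyc] set by simp
  have period: "(z ^^ k) 1 = 1 \<longleftrightarrow> m dvd k" for k
    using least_power_dvd[OF perm, of 1 k] lp by auto
  show "prime m"
    unfolding prime_nat_iff
  proof (intro conjI allI impI)
    fix d assume d: "d dvd m"
    show "d = 1 \<or> d = m"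
    proof (cases "z ^^ d = id")
      case True
      then have "m dvd d" using period[of d] by simp
      then show ?thesis using d dvd_antisym by blast
    next
      case False
      \<comment> \<open>Transitivity of \<open>z ^^ d\<close> gives
        \<open>z 1 = (z ^^ (k * d)) 1\<close>, so \<open>m\<close>, and with it \<open>d\<close>,
        divides \<open>k * d - 1\<close>. As \<open>d\<close> also divides \<open>k * d\<close>, it
        is 1.\<close>
      have "z 1 \<in> orbit_of (z ^^ d) 1"
        using orb[OF False] orbit_of_step[of z 1] orb1 by simp
      then obtain k where k: "z 1 = (z ^^ (k * d)) 1"
        by (auto simp: orbit_of_def funpow_mult mult.commute)
      have "k * d \<noteq> 0"
      proof
        assume kd0: "k * d = 0"
        have "(z ^^ 1) 1 = 1" using k unfolding kd0 by simp
        then show False using period[of 1] m by simp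
      qed
      then have kd: "k * d = Suc (k * d - 1)" by simp
      have "z 1 = z ((z ^^ (k * d - 1)) 1)" using k by (subst (asm) kd) simp
      then have "(z ^^ (k * d - 1)) 1 = 1" using permutes_inj[OF z(1)] by (metis injD)
      then have "d dvd k * d - 1" using period d dvd_trans by blast
      moreover have "d dvd k * d" by simp
      ultimately have "d dvd k * d - (k * d - 1)" using dvd_diff_nat by blast
      moreover have "k * d - (k * d - 1) = 1" using kd by linarith
      ultimately show ?thesis by simp
    qed
  qed (use m in simp)
  show "is_full_cycle m z"
    unfolding is_full_cycle_def
  proof (intro exI conjI)
    show "z = cycle_of_list (support z 1)"
    proof
      fix x
      show "z x = cycle_of_list (support z 1) x"
      proof (cases "x \<in> {1..m}")
        case True
        then show ?thesis using cycle_restrict[OF perm] set by blast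
      next
        case False
        then show ?thesis
          using id_outside_supp[of x "support z 1"] set z(1) by (simp add: permutes_def)
      qed
    qed
  qed (use cyc set in auto)
  fix g assume g: "g \<in> G"
  have gz: "g ((z ^^ j) x) = (z ^^ j) (g x)" for j x
    using commute_funpow[OF central[OF g]] by (metis comp_apply)
  have gp: "g permutes {1..m}" using g G by blast
  then have "g 1 \<in> orbit_of z 1" using orb1 one permutes_in_image[of g "{1..m}" 1] by blast
  then obtain k where k: "g 1 = (z ^^ k) 1" by (auto simp: orbit_of_def)
  \<comment> \<open>A permutation commuting with a transitive \<open>z\<close> is determined by its
    value at one point.\<close>
  have "g x = (z ^^ k) x" for x
  proof (cases "x \<in> {1..m}")
    case True
    then have "x \<in> orbit_of z 1" unfolding orb1 .
    then obtain j where j: "x = (z ^^ j) 1" unfolding orbit_of_def by blast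
    show ?thesis unfolding j gz k funpow_funpow by (simp add: add.commute)
  next
    case False
    then show ?thesis
      using gp permutes_funpow[OF z(1), of k] by (simp add: permutes_def)
  qed
  then show "\<exists>k. g = z ^^ k" by blast
qed

text \<open>For \<open>m\<close> at least 3, splitting off the point 1 gives an invariant partition
  that is neither of the two trivial ones.\<close>

lemma trivial_primitive:
  assumes m: "2 \<le> m"
    and prim: "\<And>P. invariant_partition m {id} P \<Longrightarrow> P = {{1..m}} \<or> P = (\<lambda>k. {k}) ` {1..m}"
  shows "m = 2"
proof (rule ccontr)
  assume "m \<noteq> 2"
  then have m3: "3 \<le> m" using m by simp
  have "partition_on {1..m} {{1}, {2..m}}"
    using m by (intro partition_onI) (auto simp: disjnt_def)
  then have "invariant_partition m {id} {{1}, {2..m}}"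
    by (simp add: invariant_partition_def)
  from prim[OF this] show False
  proof
    assume "{{1}, {2..m}} = {{1..m}}"
    then have "{1} = {1..m}" by blast
    moreover have "2 \<in> {1..m}" using m by simp
    ultimately show False by (metis singletonD one_eq_numeral_iff semiring_norm(83))
  next
    assume "{{1}, {2..m}} = (\<lambda>k. {k}) ` {1..m}"
    then obtain k where "{2..m} = {k}" by blast
    moreover have "2 \<in> {2..m}" "3 \<in> {2..m}" using m3 by auto
    ultimately have "(2::nat) = 3" by (metis singletonD)
    then show False by simp
  qed
qed

text \<open>Powers of the cycle carry the block of \<open>cs ! 0\<close> onto every other block. So
  all blocks have the same size, which divides the prime \<open>m\<close>.\<close>

lemma prime_full_cycle_primitive:
  assumes m: "prime m" and c: "is_full_cycle m c" "c \<in> H" and H: "H \<subseteq> {p. p permutes {1..m}}"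
    and P: "invariant_partition m H P"
  shows "P = {{1..m}} \<or> P = (\<lambda>k. {k}) ` {1..m}"
proof -
  have m1: "2 \<le> m" using m prime_ge_2_nat by blast
  have part: "partition_on {1..m} P" and inv: "\<And>A. A \<in> P \<Longrightarrow> c ` A \<in> P"
    using P c(2) by (auto simp: invariant_partition_def)
  have un: "\<Union> P = {1..m}" and ne: "{} \<notin> P" and disj: "disjoint P"
    using part by (auto simp: partition_on_def)
  obtain cs where cs: "cycle cs" "set cs = {1..m}" "c = cycle_of_list cs"
    using c(1) by (auto simp: is_full_cycle_def)
  have cp: "c permutes {1..m}" using cycle_permutes[of cs] cs by simp
  have inj: "inj (c ^^ k)" for k using permutes_inj[OF permutes_funpow[OF cp]] .
  have invk: "(c ^^ k) ` A \<in> P" if "A \<in> P" for k A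
  proof (induction k)
    case (Suc k)
    then show ?case using inv[of "(c ^^ k) ` A"] by (simp add: image_comp)
  qed (use that in simp)
  have len: "length cs = m" using distinct_card[OF cs(1)] cs(2) by simp
  have power: "(c ^^ k) (cs ! 0) = cs ! (k mod m)" for k
  proof -
    have "map (c ^^ k) cs ! 0 = rotate k cs ! 0"
      using cyclic_rotation[OF cs(1), of k] cs(3) by simp
    then show ?thesis using len m1 by (simp add: nth_rotate)
  qed
  let ?o = "cs ! 0"
  have reach: "\<exists>k. x = (c ^^ k) ?o" if "x \<in> {1..m}" for x
  proof -
    obtain k where k: "k < m" "x = cs ! k" using \<open>x \<in> {1..m}\<close> cs(2) len by (metis in_set_conv_nth)
    then have "x = (c ^^ k) ?o" using power[of k] by simp
    then show ?thesis by blast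
  qed
  have o: "?o \<in> {1..m}" using cs(2) len m1 by (metis nth_mem le_trans not_numeral_le_zero not_gr_zero)
  then obtain A where A: "A \<in> P" "?o \<in> A" using un by blast
  have card: "card B = card A" if B: "B \<in> P" for B
  proof -
    obtain x where x: "x \<in> B" using B ne by (cases "B = {}") auto
    then have "x \<in> {1..m}" using un B by blast
    then obtain k where k: "x = (c ^^ k) ?o" using reach by blast
    have "x \<in> (c ^^ k) ` A" using k A(2) by blast
    then have "B = (c ^^ k) ` A" using disj B invk[OF A(1)] x by (metis disjointD disjoint_iff)
    then show ?thesis using card_image[OF inj_on_subset[OF inj[of k]]] by simp
  qed
  have finP: "finite P" using finite_UnionD[of P] un by simp
  have fin: "finite B" if "B \<in> P" for B using that un by (metis Sup_upper finite_atLeastAtMost finite_subset)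
  have "m = card (\<Union> P)" using un by simp
  also have "\<dots> = sum card P"
    using disj fin by (intro card_Union_disjoint) (auto simp: disjoint_def pairwise_def disjnt_def)
  also have "\<dots> = card P * card A" using card by simp
  finally have "m = card P * card A" .
  then have "card A = 1 \<or> card A = m"
    using m by (metis dvd_triv_right prime_nat_iff)
  then show ?thesis
  proof
    assume one: "card A = 1"
    have "P = (\<lambda>k. {k}) ` {1..m}"
    proof (intro equalityI subsetI)
      fix B assume B: "B \<in> P"
      then obtain k where "B = {k}" using card one by (metis card_1_singletonE)
      then show "B \<in> (\<lambda>k. {k}) ` {1..m}" using un B by blast
    next
      fix B assume "B \<in> (\<lambda>k. {k}) ` {1..m}"
      then obtain k where k: "k \<in> {1..m}" "B = {k}" by blast
      then obtain C where C: "C \<in> P" "k \<in> C" using un by blast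
      then have "C = {k}" using card one by (metis card_1_singletonE singletonD)
      then show "B \<in> P" using C k by simp
    qed
    then show ?thesis by simp
  next
    assume full: "card A = m"
    have "B = {1..m}" if B: "B \<in> P" for B
      using card_subset_eq[of "{1..m}" B] card[OF B] full un B by auto
    then have "P = {{1..m}}" using A(1) by blast
    then show ?thesis by simp
  qed
qed

section \<open>Braid relations in the symmetric group on three letters\<close>

lemma permutes_3_cases:
  assumes "p permutes {1, 2, 3 :: nat}"
  shows "p = id \<or> p = transpose 1 2 \<or> p = transpose 1 3 \<or> p = transpose 2 3 \<or>
    p = transpose 1 2 \<circ> transpose 2 3 \<or> p = transpose 2 3 \<circ> transpose 1 2"
proof -
  have out: "p x = x" if "x \<noteq> 1" "x \<noteq> 2" "x \<noteq> 3" for x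
    using assms that by (simp add: permutes_def)
  have eqI: "p = q" if "p 1 = q 1" "p 2 = q 2" "p 3 = q 3"
    "\<And>x. x \<noteq> 1 \<Longrightarrow> x \<noteq> 2 \<Longrightarrow> x \<noteq> 3 \<Longrightarrow> q x = x" for q
  proof
    fix x
    show "p x = q x"
      using that out[of x] by (cases "x = 1 \<or> x = 2 \<or> x = 3") auto
  qed
  have "p 1 \<in> {1, 2, 3}" "p 2 \<in> {1, 2, 3}" "p 3 \<in> {1, 2, 3}"
    using permutes_in_image[OF assms] by blast+
  moreover have "p 1 \<noteq> p 2" "p 1 \<noteq> p 3" "p 2 \<noteq> p 3"
    by (simp_all add: inj_eq[OF permutes_inj[OF assms]])
  ultimately consider "p 1 = 1 \<and> p 2 = 2 \<and> p 3 = 3" | "p 1 = 2 \<and> p 2 = 1 \<and> p 3 = 3"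
    | "p 1 = 3 \<and> p 2 = 2 \<and> p 3 = 1" | "p 1 = 1 \<and> p 2 = 3 \<and> p 3 = 2"
    | "p 1 = 2 \<and> p 2 = 3 \<and> p 3 = 1" | "p 1 = 3 \<and> p 2 = 1 \<and> p 3 = 2"
    by auto
  then show ?thesis
  proof cases
    case 1 then have "p = id" by (intro eqI) auto
    then show ?thesis by simp
  next
    case 2 then have "p = transpose 1 2" by (intro eqI) (auto simp: transpose_def)
    then show ?thesis by simp
  next
    case 3 then have "p = transpose 1 3" by (intro eqI) (auto simp: transpose_def)
    then show ?thesis by simp
  next
    case 4 then have "p = transpose 2 3" by (intro eqI) (auto simp: transpose_def)
    then show ?thesis by simp
  next
    case 5 then have "p = transpose 1 2 \<circ> transpose 2 3" by (intro eqI) (auto simp: transpose_def)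
    then show ?thesis by simp
  next
    case 6 then have "p = transpose 2 3 \<circ> transpose 1 2" by (intro eqI) (auto simp: transpose_def)
    then show ?thesis by simp
  qed
qed

text \<open>Elements related by a braid relation are conjugate, and even permutations of three
  letters commute, so distinct ones must be transpositions. The proof checks all pairs;
  \<open>b\<close> names the shared letter, which keeps later arguments symmetric.\<close>

lemma braid_pair_transpositions_3:
  fixes p q :: "nat \<Rightarrow> nat"
  assumes pq: "p permutes {1, 2, 3}" "q permutes {1, 2, 3}" "p \<noteq> q"
    and braid: "p \<circ> q \<circ> p = q \<circ> p \<circ> q"
  obtains a b c where "{a, b, c} = {1, 2, 3}" "p = transpose a b" "q = transpose b c"
proof -
  have b: "p (q (p x)) = q (p (q x))" for x using braid by (metis comp_apply)
  note vals = b[of 1] b[of 2] b[of 3]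
  have "(p = transpose 1 2 \<and> q = transpose 2 3) \<or> (p = transpose 1 2 \<and> q = transpose 1 3) \<or>
     (p = transpose 1 3 \<and> q = transpose 2 3) \<or> (p = transpose 1 3 \<and> q = transpose 1 2) \<or>
     (p = transpose 2 3 \<and> q = transpose 1 2) \<or> (p = transpose 2 3 \<and> q = transpose 1 3)"
    using permutes_3_cases[OF pq(1)] permutes_3_cases[OF pq(2)] pq(3)
    by (elim disjE) (use vals in \<open>simp_all add: transpose_def\<close>)
  then show ?thesis
  proof (elim disjE conjE)
    assume "p = transpose 1 2" "q = transpose 2 3" then show ?thesis by (intro that[of 1 2 3]) auto
  next
    assume "p = transpose 1 2" "q = transpose 1 3" then show ?thesis by (intro that[of 2 1 3]) (auto simp: transpose_commute)
  next
    assume "p = transpose 1 3" "q = transpose 2 3" then show ?thesis by (intro that[of 1 3 2]) (auto simp: transpose_commute)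
  next
    assume "p = transpose 1 3" "q = transpose 1 2" then show ?thesis by (intro that[of 3 1 2]) (auto simp: transpose_commute)
  next
    assume "p = transpose 2 3" "q = transpose 1 2" then show ?thesis by (intro that[of 3 2 1]) (auto simp: transpose_commute)
  next
    assume "p = transpose 2 3" "q = transpose 1 3" then show ?thesis by (intro that[of 2 3 1]) (auto simp: transpose_commute)
  qed
qed

lemma conj_transpose:
  assumes "bij \<pi>"
  shows "\<pi> \<circ> transpose a b \<circ> inv' \<pi> = transpose (\<pi> a) (\<pi> b)"
proof
  fix x
  obtain y where "x = \<pi> y" using assms by (meson bij_pointE)
  then show "(\<pi> \<circ> transpose a b \<circ> inv' \<pi>) x = transpose (\<pi> a) (\<pi> b) x"
    using assms by (auto simp: transpose_def bij_is_inj inv_f_f inj_eq)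
qed

lemma braid_pair_normal_form_3:
  fixes p q :: "nat \<Rightarrow> nat"
  assumes pq: "p permutes {1, 2, 3}" "q permutes {1, 2, 3}" "p \<noteq> q"
    and braid: "p \<circ> q \<circ> p = q \<circ> p \<circ> q"
  obtains \<pi> where "\<pi> permutes {1, 2, 3}"
    "\<pi> \<circ> p \<circ> inv' \<pi> = transpose 1 2" "\<pi> \<circ> q \<circ> inv' \<pi> = transpose 2 3"
proof -
  obtain a b c where abc: "{a, b, c} = {1, 2, 3}" "p = transpose a b" "q = transpose b c"
    using braid_pair_transpositions_3[OF assms] .
  have "card {a, b, c} = 3" using abc(1) by simp
  then have d: "a \<noteq> b" "b \<noteq> c" "a \<noteq> c" by (auto simp: card_insert_if split: if_splits)
  \<comment> \<open>This is the renumbering that sends \<open>a\<close>, \<open>b\<close>,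
    \<open>c\<close> to 1, 2, 3.\<close>
  define \<pi> where "\<pi> x = (if x = a then 1 else if x = b then 2 else if x = c then 3 else x)" for x
  have img: "\<pi> ` {a, b, c} = {1, 2, 3}" using d by (auto simp: \<pi>_def)
  moreover have "inj_on \<pi> {a, b, c}" using d by (auto simp: \<pi>_def inj_on_def)
  ultimately have "bij_betw \<pi> {1, 2, 3} {1, 2, 3}"
    unfolding abc(1) by (simp add: bij_betw_def)
  moreover have "\<pi> x = x" if "x \<notin> {1, 2, 3}" for x
    using that unfolding abc(1)[symmetric] by (auto simp: \<pi>_def)
  ultimately have \<pi>: "\<pi> permutes {1, 2, 3}" by (rule bij_imp_permutes)
  show ?thesis
    using that[OF \<pi>] conj_transpose[OF permutes_bij[OF \<pi>]] abc(2,3) d by (simp add: \<pi>_def)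
qed

text \<open>The two transpositions generate the full symmetric group on three letters, whose centre
  is trivial. Concretely, \<open>c\<close> fixes the unique fixed letter of \<open>p\<close> and
  that of \<open>q\<close>.\<close>

lemma commutes_with_braid_pair_3:
  fixes p q c :: "nat \<Rightarrow> nat"
  assumes pq: "p permutes {1, 2, 3}" "q permutes {1, 2, 3}" "p \<noteq> q"
    and braid: "p \<circ> q \<circ> p = q \<circ> p \<circ> q"
    and c: "c permutes {1, 2, 3}" "c \<circ> p = p \<circ> c" "c \<circ> q = q \<circ> c"
  shows "c = id"
proof -
  obtain x y z where xyz: "{x, y, z} = {1, 2, 3}" "p = transpose x y" "q = transpose y z"
    using braid_pair_transpositions_3[OF pq braid] .
  have "card {x, y, z} = 3" using xyz(1) by simp
  then have d: "x \<noteq> y" "y \<noteq> z" "x \<noteq> z" by (auto simp: card_insert_if split: if_splits)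
  have cp: "c (transpose x y w) = transpose x y (c w)" for w using c(2) xyz(2) by (metis comp_apply)
  have cq: "c (transpose y z w) = transpose y z (c w)" for w using c(3) xyz(3) by (metis comp_apply)
  have mem: "c w \<in> {x, y, z}" if "w \<in> {x, y, z}" for w
    using permutes_in_image[OF c(1)] that xyz(1) by simp
  have cx: "c x = x" using cq[of x] mem[of x] d by (auto simp: transpose_def split: if_splits)
  have cz: "c z = z" using cp[of z] mem[of z] d by (auto simp: transpose_def split: if_splits)
  have cy: "c y = y" using cp[of x] cx d by simp
  have "c w = w" for w
  proof (cases "w \<in> {x, y, z}")
    case False
    then show ?thesis using c(1) xyz(1) by (simp add: permutes_def)
  qed (use cx cy cz in auto)
  then show ?thesis by auto
qed

text \<open>If \<open>r\<close> equalled \<open>q\<close>, then \<open>p\<close> and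
  \<open>q\<close> would commute and hence be equal. So \<open>r\<close> is a transposition, and
  commuting transpositions of three letters coincide.\<close>

lemma braid_third_3:
  fixes p q r :: "nat \<Rightarrow> nat"
  assumes pq: "p permutes {1, 2, 3}" "q permutes {1, 2, 3}" "p \<noteq> q"
    and braid: "p \<circ> q \<circ> p = q \<circ> p \<circ> q"
    and r: "r permutes {1, 2, 3}" "r \<circ> p = p \<circ> r" "q \<circ> r \<circ> q = r \<circ> q \<circ> r"
  shows "r = p"
proof -
  have "q \<noteq> r"
  proof
    assume "q = r"
    then have "p \<circ> p \<circ> q = p \<circ> q \<circ> q" using braid r(2) by (metis comp_assoc)
    then have "p \<circ> q = q \<circ> q" using permutes_inj[OF pq(1)] by (simp add: comp_assoc fun.inj_map_strong fun_eq_iff inj_eq)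
    then have "p (q w) = q (q w)" for w by (metis comp_apply)
    then have "p w = q w" for w using permutes_surj[OF pq(2)] by (metis surjD)
    then show False using pq(3) by auto
  qed
  obtain x y z where xyz: "{x, y, z} = {1, 2, 3}" "p = transpose x y" "q = transpose y z"
    using braid_pair_transpositions_3[OF pq braid] .
  obtain u v w where uvw: "{u, v, w} = {1, 2, 3}" "q = transpose u v" "r = transpose v w"
    using braid_pair_transpositions_3[OF pq(2) r(1) \<open>q \<noteq> r\<close> r(3)] .
  have "card {x, y, z} = 3" "card {u, v, w} = 3" using xyz(1) uvw(1) by simp_all
  then have d: "x \<noteq> y" "y \<noteq> z" "x \<noteq> z" "u \<noteq> v" "v \<noteq> w" "u \<noteq> w"
    by (auto simp: card_insert_if split: if_splits)
  have rp: "r (p z) = p (r z)" using r(2) by (metis comp_apply)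
  have q: "transpose y z = transpose u v" using xyz(3) uvw(2) by simp
  have "{u, v} = {y, z}"
    using fun_cong[OF q, of y] fun_cong[OF q, of z] d by (auto simp: transpose_def split: if_splits)
  moreover have "w = x" using calculation xyz(1) uvw(1) d by blast
  moreover have "v \<noteq> z"
    using rp xyz(2) uvw(3) \<open>w = x\<close> d by (auto simp: transpose_def split: if_splits)
  ultimately have "v = y" by blast
  then show ?thesis using uvw(3) xyz(2) \<open>w = x\<close> by (simp add: transpose_commute)
qed

section \<open>Representations of surface braid groups\<close>

locale braid_rep =
  fixes g n m :: nat and \<rho> :: "braid_gen word set \<Rightarrow> nat \<Rightarrow> nat"
  assumes hom: "\<rho> \<in> hom (surface_braid_group g n) (sym_group m)"
begin

definition gen :: "braid_gen \<Rightarrow> nat \<Rightarrow> nat" where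
  "gen x = \<rho> (sbg_gen g n x)"

definition image :: "(nat \<Rightarrow> nat) set" where
  "image = \<rho> ` carrier (surface_braid_group g n)"

lemma gen_in_image: "x \<in> braid_gens g n \<Longrightarrow> gen x \<in> image"
  unfolding gen_def image_def sbg_gen_def surface_braid_group_def
  by (intro imageI pres_gen_closed)

lemma image_permutes: "image \<subseteq> {p. p permutes {1..m}}"
  using hom by (auto simp: image_def hom_def sym_group_carrier)

lemma gen_permutes: "x \<in> braid_gens g n \<Longrightarrow> gen x permutes {1..m}"
  using gen_in_image image_permutes by blast

lemma relation:
  assumes "(u, v) \<in> braid_rels g n" "u \<in> words (braid_gens g n)" "v \<in> words (braid_gens g n)"
  shows "word_val (sym_group m) gen u = word_val (sym_group m) gen v"
  using presented_group_relation[OF sym_group_is_group hom[unfolded surface_braid_group_def] assms]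
  by (simp add: gen_def[abs_def] sbg_gen_def)

lemma commutes_image:
  assumes comm: "\<And>x. x \<in> braid_gens g n \<Longrightarrow> gen x \<circ> z = z \<circ> gen x" and h: "h \<in> image"
  shows "h \<circ> z = z \<circ> h"
proof (rule presented_group_hom_induct[OF sym_group_is_group hom[unfolded surface_braid_group_def]
      h[unfolded image_def surface_braid_group_def], of "\<lambda>h. h \<circ> z = z \<circ> h"])
  fix x h assume x: "x \<in> braid_gens g n" and h: "h \<circ> z = z \<circ> h"
  have c: "gen x \<circ> z = z \<circ> gen x" using comm x by blast
  have "gen x (z w) = z (gen x w)" "h (z w) = z (h w)" for w
    using c h by (metis comp_apply)+
  then show "\<rho> (pres_gen (braid_gens g n) (braid_rels g n) x) \<otimes>\<^bsub>sym_group m\<^esub> h \<circ> z =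
      z \<circ> (\<rho> (pres_gen (braid_gens g n) (braid_rels g n) x) \<otimes>\<^bsub>sym_group m\<^esub> h)"
    by (simp add: sym_group_mult fun_eq_iff gen_def sbg_gen_def)
  have p: "gen x permutes {1..m}" using gen_permutes x by blast
  have "inv' (gen x) (z w) = z (inv' (gen x) w)" for w
    using \<open>\<And>w. gen x (z w) = z (gen x w)\<close> permutes_inverses[OF p] by metis
  then have "inv' (gen x) \<circ> h \<circ> z = z \<circ> (inv' (gen x) \<circ> h)"
    using \<open>\<And>w. h (z w) = z (h w)\<close> by (simp add: fun_eq_iff)
  moreover have "inv\<^bsub>sym_group m\<^esub> gen x = inv' (gen x)"
    using p by (simp add: sym_group_carrier)
  ultimately show "inv\<^bsub>sym_group m\<^esub> \<rho> (pres_gen (braid_gens g n) (braid_rels g n) x) \<otimes>\<^bsub>sym_group m\<^esub> h \<circ> z =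
      z \<circ> (inv\<^bsub>sym_group m\<^esub> \<rho> (pres_gen (braid_gens g n) (braid_rels g n) x) \<otimes>\<^bsub>sym_group m\<^esub> h)"
    by (simp add: sym_group_mult gen_def sbg_gen_def)
qed (simp add: sym_group_one)

lemma trivial_image:
  assumes triv: "\<And>x. x \<in> braid_gens g n \<Longrightarrow> gen x = id"
  shows "image = {id}"
proof -
  have "h = id" if h: "h \<in> image" for h
  proof (rule presented_group_hom_induct[OF sym_group_is_group hom[unfolded surface_braid_group_def]
      h[unfolded image_def surface_braid_group_def], of "\<lambda>h. h = id"])
    fix x h assume "x \<in> braid_gens g n" "h = (id :: nat \<Rightarrow> nat)"
    moreover from this have "\<rho> (pres_gen (braid_gens g n) (braid_rels g n) x) = id"
      using triv by (simp add: gen_def sbg_gen_def)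
    ultimately show "\<rho> (pres_gen (braid_gens g n) (braid_rels g n) x) \<otimes>\<^bsub>sym_group m\<^esub> h = id"
      "inv\<^bsub>sym_group m\<^esub> \<rho> (pres_gen (braid_gens g n) (braid_rels g n) x) \<otimes>\<^bsub>sym_group m\<^esub> h = id"
      by (simp_all add: sym_group_mult sym_group_carrier permutes_id)
  qed (simp add: sym_group_one)
  moreover have "image \<noteq> {}"
    using group.is_monoid[OF group_presented_group] monoid.one_closed
    unfolding image_def surface_braid_group_def by blast
  ultimately show ?thesis by blast
qed

lemma image_generate:
  assumes z: "z \<in> image" and powers: "\<And>h. h \<in> image \<Longrightarrow> \<exists>k. h = z ^^ k"
  shows "image = generate (sym_group m) {z}"
proof
  interpret G: group "surface_braid_group g n"
    unfolding surface_braid_group_def by (rule group_presented_group)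
  interpret S: group "sym_group m" by (rule sym_group_is_group)
  interpret group_hom "surface_braid_group g n" "sym_group m" \<rho>
    using hom by unfold_locales
  have "subgroup image (sym_group m)"
    unfolding image_def by (rule img_is_subgroup)
  then show "generate (sym_group m) {z} \<subseteq> image"
    using z by (intro S.generate_subgroup_incl) auto
  have "z ^^ k \<in> generate (sym_group m) {z}" for k
  proof (induction k)
    case 0
    show ?case using generate.one[of "sym_group m" "{z}"] by (simp add: sym_group_one id_def)
  next
    case (Suc k)
    have "z \<otimes>\<^bsub>sym_group m\<^esub> (z ^^ k) \<in> generate (sym_group m) {z}"
      using generate.eng[OF generate.incl[of z "{z}" "sym_group m"] Suc.IH] by simp
    then show ?case unfolding sym_group_mult funpow.simps .
  qed
  then show "image \<subseteq> generate (sym_group m) {z}" using powers by blast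
qed

section \<open>The defining relations read in the symmetric group\<close>

lemma gen_s_far:
  assumes "i \<in> {1..<n}" "j \<in> {1..<n}" "i + 2 \<le> j \<or> j + 2 \<le> i"
  shows "gen (Gen_s i) \<circ> gen (Gen_s j) = gen (Gen_s j) \<circ> gen (Gen_s i)"
  using relation[OF braid_rels.far_comm[OF assms]] assms
  by (auto simp: braid_gens_def sym_group_mult sym_group_one)

lemma gen_s_braid:
  assumes "1 \<le> i" "i + 2 \<le> n"
  shows "gen (Gen_s i) \<circ> gen (Gen_s (i + 1)) \<circ> gen (Gen_s i) =
    gen (Gen_s (i + 1)) \<circ> gen (Gen_s i) \<circ> gen (Gen_s (i + 1))"
  using relation[OF braid_rels.braid[OF assms]] assms
  by (auto simp: braid_gens_def sym_group_mult sym_group_one o_assoc)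

lemma gen_handle_comm:
  assumes "i \<in> {1..g}" "c \<in> {Gen_a i, Gen_b i}" "2 \<le> j" "j < n"
  shows "gen c \<circ> gen (Gen_s j) = gen (Gen_s j) \<circ> gen c"
  using relation[OF braid_rels.handle_comm[OF assms]] assms
  by (auto simp: braid_gens_def sym_group_mult sym_group_one)

lemma gen_handle_pair:
  assumes "i \<in> {1..g}" "2 \<le> n"
  shows "gen (Gen_a i) \<circ> gen (Gen_s 1) \<circ> gen (Gen_b i) =
    gen (Gen_s 1) \<circ> gen (Gen_b i) \<circ> gen (Gen_s 1) \<circ> gen (Gen_a i) \<circ> gen (Gen_s 1)"
  using relation[OF braid_rels.handle_pair[OF assms(1)]] assms
  by (auto simp: braid_gens_def sym_group_mult sym_group_one o_assoc)

lemma gen_handles_comm: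
  assumes ij: "1 \<le> j" "j < i" "i \<le> g" and c: "c \<in> {Gen_a i, Gen_b i}" and d: "d \<in> {Gen_a j, Gen_b j}"
    and n: "2 \<le> n"
  shows "gen c \<circ> inv' (gen (Gen_s 1)) \<circ> gen d \<circ> gen (Gen_s 1) =
    inv' (gen (Gen_s 1)) \<circ> gen d \<circ> gen (Gen_s 1) \<circ> gen c"
proof -
  have mem: "Gen_s 1 \<in> braid_gens g n" "c \<in> braid_gens g n" "d \<in> braid_gens g n"
    using ij c d n by (auto simp: braid_gens_def)
  have "inv\<^bsub>sym_group m\<^esub> gen (Gen_s 1) = inv' (gen (Gen_s 1))"
    using gen_permutes[OF mem(1)] by (simp add: sym_group_carrier)
  then show ?thesis
    using relation[OF braid_rels.handles_comm[OF ij c d]] mem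
    by (simp add: sym_group_mult sym_group_one o_assoc)
qed

lemma braid_action: "braid_action n {1..m} (\<lambda>i. gen (Gen_s i))"
proof
  show "bij_betw (gen (Gen_s i)) {1..m} {1..m}" if "1 \<le> i" "i < n" for i
    using that gen_permutes[of "Gen_s i"] by (auto simp: braid_gens_def intro: permutes_imp_bij)
  show "gen (Gen_s i) (gen (Gen_s j) x) = gen (Gen_s j) (gen (Gen_s i) x)"
    if "1 \<le> i" "i + 2 \<le> j" "j < n" for i j x
    using gen_s_far[of i j] that by (simp add: fun_eq_iff)
  show "gen (Gen_s i) (gen (Gen_s (i + 1)) (gen (Gen_s i) x)) =
      gen (Gen_s (i + 1)) (gen (Gen_s i) (gen (Gen_s (i + 1)) x))"
    if "1 \<le> i" "i + 1 < n" for i x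
    using gen_s_braid[of i] that by (simp add: fun_eq_iff)
qed simp

sublocale Braid: braid_action n "{1..m}" "\<lambda>i. gen (Gen_s i)"
  by (rule braid_action)

lemma const_gen_s:
  assumes "Braid.const" "i \<in> {1..<n}"
  shows "gen (Gen_s i) = gen (Gen_s 1)"
proof
  fix x
  show "gen (Gen_s i) x = gen (Gen_s 1) x"
  proof (cases "x \<in> {1..m}")
    case True
    then show ?thesis using Braid.constD[OF assms(1), of i 1 x] assms(2) by simp
  next
    case False
    then show ?thesis
      using gen_permutes[of "Gen_s i"] gen_permutes[of "Gen_s 1"] assms(2)
      by (auto simp: braid_gens_def permutes_def)
  qed
qed

section \<open>Classification of primitive representations\<close>

lemma gens_cases:
  assumes "x \<in> braid_gens g n"
  obtains (handle) i where "i \<in> {1..g}" "x \<in> {Gen_a i, Gen_b i}" | (s) i where "i \<in> {1..<n}" "x = Gen_s i"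
  using assms by (auto simp: braid_gens_def)

text \<open>A common nontrivial image of the braid generators is central. If it is trivial, the
  relations between handles become commutation relations and the image is abelian, so any nontrivial
  generator serves as the central element.\<close>

lemma cyclic_case:
  assumes const: "Braid.const" and n: "3 \<le> n" and m: "2 \<le> m"
    and prim: "\<And>P. invariant_partition m image P \<Longrightarrow> P = {{1..m}} \<or> P = (\<lambda>k. {k}) ` {1..m}"
  shows "prime m \<and> ((\<exists>c. is_full_cycle m c \<and> image = generate (sym_group m) {c}) \<or>
    (m = 2 \<and> image = {id}))"
proof -
  have s: "gen (Gen_s i) = gen (Gen_s 1)" if "i \<in> {1..<n}" for i
    using const_gen_s[OF const that] .
  have *: ?thesis if z: "x \<in> braid_gens g n" "gen x \<noteq> id"
    and comm: "\<And>y. y \<in> braid_gens g n \<Longrightarrow> gen y \<circ> gen x = gen x \<circ> gen y" for x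
  proof -
    note ce = central_element[OF m image_permutes prim gen_permutes[OF z(1)] z(2) commutes_image[OF comm]]
    show ?thesis using ce(1,2) image_generate[OF gen_in_image[OF z(1)] ce(3)] by blast
  qed
  show ?thesis
  proof (cases "gen (Gen_s 1) = id")
    case False
    have "gen y \<circ> gen (Gen_s 1) = gen (Gen_s 1) \<circ> gen y" if "y \<in> braid_gens g n" for y
      using that
    proof (cases rule: gens_cases)
      case (handle i)
      \<comment> \<open>The handle relation gives commutation only from the second braid generator
        on, which here has the same image as the first.\<close>
      then show ?thesis using gen_handle_comm[of i y 2] s[of 2] n by simp
    next
      case sigma: (s i)
      then show ?thesis using s[OF sigma(1)] by simp
    qed
    moreover have "Gen_s 1 \<in> braid_gens g n" using n by (auto simp: braid_gens_def)
    ultimately show ?thesis using * False by blast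
  next
    case True
    have comm_less: "gen x \<circ> gen y = gen y \<circ> gen x"
      if "1 \<le> j" "j < i" "i \<le> g" "x \<in> {Gen_a i, Gen_b i}" "y \<in> {Gen_a j, Gen_b j}" for i j x y
      using gen_handles_comm[OF that] n True by simp
    have "gen x \<circ> gen y = gen y \<circ> gen x" if x: "x \<in> braid_gens g n" and y: "y \<in> braid_gens g n" for x y
      using x
    proof (cases rule: gens_cases)
      case sigma: (s i)
      then show ?thesis using s[OF sigma(1)] True by simp
    next
      case x: (handle i)
      show ?thesis using y
      proof (cases rule: gens_cases)
        case sigma: (s i)
        then show ?thesis using s[OF sigma(1)] True by simp
      next
        case y: (handle j)
        consider "j < i" | "i < j" | "i = j" by linarith
        then show ?thesis
        proof cases
          case 1
          then show ?thesis using comm_less x y by simp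
        next
          case 2
          then show ?thesis using comm_less[of i j y x] x y by simp
        next
          case 3
          then show ?thesis using gen_handle_pair[of i] True n x y by auto
        qed
      qed
    qed
    then have "?thesis" if "x \<in> braid_gens g n" "gen x \<noteq> id" for x
      using * that by blast
    moreover have ?thesis if "\<And>x. x \<in> braid_gens g n \<Longrightarrow> gen x = id"
    proof -
      have im: "image = {id}" using trivial_image that by blast
      then have "m = 2" using trivial_primitive[OF m] prim by simp
      then show ?thesis using im by (simp add: two_is_prime_nat)
    qed
    ultimately show ?thesis by blast
  qed
qed

text \<open>The third braid generator commutes with the first and is braided with the second, so it
  has the image of the first. Handle generators commute with the second and third, hence with a pair
  generating the whole symmetric group, and are trivial.\<close>

lemma exceptional_case:
  assumes n: "n = 4" and m: "m = 3" and "\<not> Braid.const"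
  shows "\<exists>\<pi>. \<pi> permutes {1, 2, 3} \<and>
    \<pi> \<circ> gen (Gen_s 1) \<circ> inv' \<pi> = transpose 1 2 \<and>
    \<pi> \<circ> gen (Gen_s 3) \<circ> inv' \<pi> = transpose 1 2 \<and>
    \<pi> \<circ> gen (Gen_s 2) \<circ> inv' \<pi> = transpose 2 3 \<and>
    (\<forall>i\<in>{1..g}. gen (Gen_a i) = id \<and> gen (Gen_b i) = id)"
proof -
  have set3: "{1..m} = {1, 2, 3}" unfolding m by auto
  have perm: "gen x permutes {1, 2, 3}" if "x \<in> braid_gens g n" for x
    using gen_permutes[OF that] unfolding set3 .
  have s: "gen (Gen_s 1) permutes {1, 2, 3}" "gen (Gen_s 2) permutes {1, 2, 3}"
    "gen (Gen_s 3) permutes {1, 2, 3}"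
    by (rule perm; use n in \<open>auto simp: braid_gens_def\<close>)+
  have ne: "gen (Gen_s 1) \<noteq> gen (Gen_s 2)"
  proof
    assume eq: "gen (Gen_s 1) = gen (Gen_s 2)"
    have "gen (Gen_s 1) x = gen (Gen_s (1 + 1)) x" for x unfolding eq one_add_one ..
    then have Braid.const using n by (intro Braid.const_if_neighbours_eq[of 1]) auto
    then show False using assms(3) by blast
  qed
  have b12: "gen (Gen_s 1) \<circ> gen (Gen_s 2) \<circ> gen (Gen_s 1) =
      gen (Gen_s 2) \<circ> gen (Gen_s 1) \<circ> gen (Gen_s 2)"
    using gen_s_braid[of 1] n by (simp add: numeral_2_eq_2)
  have b23: "gen (Gen_s 2) \<circ> gen (Gen_s 3) \<circ> gen (Gen_s 2) =
      gen (Gen_s 3) \<circ> gen (Gen_s 2) \<circ> gen (Gen_s 3)"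
    using gen_s_braid[of 2] n by simp
  have s13: "gen (Gen_s 3) = gen (Gen_s 1)"
    using gen_s_far[of 3 1] n by (intro braid_third_3[OF s(1,2) ne b12 s(3) _ b23]) simp
  have handle: "gen c = id" if "i \<in> {1..g}" "c \<in> {Gen_a i, Gen_b i}" for i c
  proof (rule commutes_with_braid_pair_3[OF s(1,2) ne b12])
    show "gen c permutes {1, 2, 3}" using that by (intro perm) (auto simp: braid_gens_def)
    show "gen c \<circ> gen (Gen_s 1) = gen (Gen_s 1) \<circ> gen c"
      using gen_handle_comm[OF that, of 3] n s13 by simp
    show "gen c \<circ> gen (Gen_s 2) = gen (Gen_s 2) \<circ> gen c"
      using gen_handle_comm[OF that, of 2] n by simp
  qed
  obtain \<pi> where "\<pi> permutes {1, 2, 3}" "\<pi> \<circ> gen (Gen_s 1) \<circ> inv' \<pi> = transpose 1 2"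
    "\<pi> \<circ> gen (Gen_s 2) \<circ> inv' \<pi> = transpose 2 3"
    using braid_pair_normal_form_3[OF s(1,2) ne b12] .
  then show ?thesis using s13 handle by (intro exI[of _ \<pi>]) auto
qed

lemma const_or_exceptional:
  assumes "m < n" "2 \<le> m"
  shows "Braid.const \<or> n = 4 \<and> m = 3"
proof -
  consider "n = 3 \<or> 5 \<le> n" | "n = 4" "m = 2" | "n = 4" "m = 3" using assms by linarith
  then show ?thesis
  proof cases
    case 1
    then show ?thesis using Braid.Artin assms by simp
  next
    case 2
    have "gen (Gen_s 1) x = gen (Gen_s (1 + 1)) x" if "x \<in> {1..m}" for x
      using Braid.two_points[of x] that 2 unfolding one_add_one by simp
    then show ?thesis using 2 by (intro disjI1 Braid.const_if_neighbours_eq[of 1]) auto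
  qed simp
qed

end

section \<open>Existence of primitive representations for prime \<open>m\<close>\<close>

lemma cyclic_rep_exists:
  assumes g: "1 \<le> g" and c: "c permutes {1..m}"
  obtains \<rho> where "\<rho> \<in> hom (surface_braid_group g n) (sym_group m)"
    "\<rho> (sbg_gen g n (Gen_a 1)) = c"
proof -
  \<comment> \<open>Only the first \<open>a\<close> generator acts nontrivially. It occurs equally
    often on both sides of each relation except the surface relation, where it occurs in a
    commutator with an element sent to \<open>id\<close>.\<close>
  let ?f = "\<lambda>x. if x = Gen_a 1 then c else id"
  have car: "c \<in> carrier (sym_group m)" "id \<in> carrier (sym_group m)"
    using c by (simp_all add: sym_group_carrier permutes_id)
  have inv_id: "inv\<^bsub>sym_group m\<^esub> id = id" using car by simp
  have cc: "inv' c (c x) = x" for x using permutes_inverses(2)[OF c] .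
  have comm: "word_val (sym_group m) ?f
      (concat (map (\<lambda>i. [ltr_inv (Gen_a i), ltr (Gen_b i), ltr (Gen_a i), ltr_inv (Gen_b i)]) is)) = id" for "is"
    by (induction "is") (simp_all add: sym_group_mult sym_group_one inv_id car o_assoc cc)
  have sigmas: "word_val (sym_group m) ?f (map (\<lambda>i. ltr (Gen_s i)) is) = id" for "is"
    by (induction "is") (simp_all add: sym_group_mult sym_group_one)
  have rels: "word_val (sym_group m) ?f u = word_val (sym_group m) ?f v" if "(u, v) \<in> braid_rels g n" for u v
    using that
  proof cases
    case surface
    show ?thesis unfolding surface comm sigmas ..
  qed (auto simp: sym_group_mult sym_group_one inv_id)
  have f: "?f \<in> braid_gens g n \<rightarrow> carrier (sym_group m)" using car by simp
  obtain \<rho> where "\<rho> \<in> hom (presented_group (braid_gens g n) (braid_rels g n)) (sym_group m)"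
    "\<And>x. x \<in> braid_gens g n \<Longrightarrow> \<rho> (pres_gen (braid_gens g n) (braid_rels g n) x) = ?f x"
    by (rule presented_group_lift[OF sym_group_is_group f, of "braid_rels g n"])
      (use rels in blast)+
  moreover have "Gen_a 1 \<in> braid_gens g n" using g by (auto simp: braid_gens_def)
  ultimately show ?thesis
    using that by (simp add: surface_braid_group_def sbg_gen_def)
qed

lemma primitive_rep_exists:
  assumes m: "prime m" and g: "1 \<le> g"
  shows "\<exists>\<rho>. primitive_rep g n m \<rho>"
proof -
  define c where "c = cycle_of_list [1..<m + 1]"
  have set: "set [1..<m + 1] = {1..m}" by auto
  have c: "c permutes {1..m}" using cycle_permutes[of "[1..<m + 1]"] unfolding c_def set .
  have cyc: "is_full_cycle m c"
    unfolding is_full_cycle_def c_def using set by (intro exI[of _ "[1..<m + 1]"]) simp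
  obtain \<rho> where \<rho>: "\<rho> \<in> hom (surface_braid_group g n) (sym_group m)" "\<rho> (sbg_gen g n (Gen_a 1)) = c"
    using cyclic_rep_exists[OF g c] .
  interpret braid_rep g n m \<rho> using \<rho>(1) by unfold_locales
  have "c \<in> image" using gen_in_image[of "Gen_a 1"] \<rho>(2) g by (auto simp: braid_gens_def gen_def)
  then have "primitive_rep g n m \<rho>"
    unfolding primitive_rep_def image_def[symmetric]
    using \<rho>(1) prime_full_cycle_primitive[OF m cyc _ image_permutes] by blast
  then show ?thesis by blast
qed

theorem theorem1p5:
  fixes g n m :: nat
  assumes "n > m" and "m \<ge> 2" and "g \<ge> 1"
  shows "((\<exists>\<rho>. primitive_rep g n m \<rho>) \<longleftrightarrow> prime m) \<and>
    (prime m \<longrightarrow> (\<forall>\<rho>. primitive_rep g n m \<rho> \<longrightarrow>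
      ((\<exists>c. is_full_cycle m c \<and>
            \<rho> ` carrier (surface_braid_group g n) = generate (sym_group m) {c}) \<or>
       (m = 2 \<and> \<rho> ` carrier (surface_braid_group g n) = {id}))
      \<or>
      (n = 4 \<and> m = 3 \<and>
       (\<exists>\<pi>. \<pi> permutes {1, 2, 3} \<and>
          \<pi> \<circ> \<rho> (sbg_gen g n (Gen_s 1)) \<circ> inv' \<pi> = transpose 1 2 \<and>
          \<pi> \<circ> \<rho> (sbg_gen g n (Gen_s 3)) \<circ> inv' \<pi> = transpose 1 2 \<and>
          \<pi> \<circ> \<rho> (sbg_gen g n (Gen_s 2)) \<circ> inv' \<pi> = transpose 2 3 \<and>
          (\<forall>i\<in>{1..g}. \<rho> (sbg_gen g n (Gen_a i)) = id \<and>
                      \<rho> (sbg_gen g n (Gen_b i)) = id)))))"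
proof -
  \<comment> \<open>Primality is part of the conclusion, so that one statement yields both the
    forward implication and the classification.\<close>
  have main: "prime m \<and> (((\<exists>c. is_full_cycle m c \<and>
            \<rho> ` carrier (surface_braid_group g n) = generate (sym_group m) {c}) \<or>
       (m = 2 \<and> \<rho> ` carrier (surface_braid_group g n) = {id}))
      \<or>
      (n = 4 \<and> m = 3 \<and>
       (\<exists>\<pi>. \<pi> permutes {1, 2, 3} \<and>
          \<pi> \<circ> \<rho> (sbg_gen g n (Gen_s 1)) \<circ> inv' \<pi> = transpose 1 2 \<and>
          \<pi> \<circ> \<rho> (sbg_gen g n (Gen_s 3)) \<circ> inv' \<pi> = transpose 1 2 \<and>
          \<pi> \<circ> \<rho> (sbg_gen g n (Gen_s 2)) \<circ> inv' \<pi> = transpose 2 3 \<and>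
          (\<forall>i\<in>{1..g}. \<rho> (sbg_gen g n (Gen_a i)) = id \<and>
                      \<rho> (sbg_gen g n (Gen_b i)) = id))))"
    if "primitive_rep g n m \<rho>" for \<rho>
  proof -
    interpret braid_rep g n m \<rho> using that by (simp add: primitive_rep_def braid_rep_def)
    have prim: "P = {{1..m}} \<or> P = (\<lambda>k. {k}) ` {1..m}" if "invariant_partition m image P" for P
      using \<open>primitive_rep g n m \<rho>\<close> that by (simp add: primitive_rep_def image_def)
    show ?thesis
    proof (cases Braid.const)
      case True
      have "prime m \<and> ((\<exists>c. is_full_cycle m c \<and> image = generate (sym_group m) {c}) \<or>
          (m = 2 \<and> image = {id}))"
        using assms by (intro cyclic_case[OF True] prim) simp_all
      then show ?thesis unfolding image_def by blast
    next
      case False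
      then have "n = 4" "m = 3" using const_or_exceptional assms by auto
      then show ?thesis
        using exceptional_case[OF _ _ False] unfolding gen_def by simp
    qed
  qed
  show ?thesis
  proof (intro conjI impI allI iffI)
    assume "\<exists>\<rho>. primitive_rep g n m \<rho>"
    then show "prime m" using main by (elim exE) (rule conjunct1)
  next
    assume "prime m"
    then show "\<exists>\<rho>. primitive_rep g n m \<rho>" by (rule primitive_rep_exists[OF _ assms(3)])
  next
    fix \<rho> assume "primitive_rep g n m \<rho>"
    from conjunct2[OF main[OF this]]
    show "((\<exists>c. is_full_cycle m c \<and>
            \<rho> ` carrier (surface_braid_group g n) = generate (sym_group m) {c}) \<or>
       (m = 2 \<and> \<rho> ` carrier (surface_braid_group g n) = {id}))
      \<or>
      (n = 4 \<and> m = 3 \<and>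
       (\<exists>\<pi>. \<pi> permutes {1, 2, 3} \<and>
          \<pi> \<circ> \<rho> (sbg_gen g n (Gen_s 1)) \<circ> inv' \<pi> = transpose 1 2 \<and>
          \<pi> \<circ> \<rho> (sbg_gen g n (Gen_s 3)) \<circ> inv' \<pi> = transpose 1 2 \<and>
          \<pi> \<circ> \<rho> (sbg_gen g n (Gen_s 2)) \<circ> inv' \<pi> = transpose 2 3 \<and>
          (\<forall>i\<in>{1..g}. \<rho> (sbg_gen g n (Gen_a i)) = id \<and>
                      \<rho> (sbg_gen g n (Gen_b i)) = id)))" .
  qed
qed

end
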